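(* Let $\mathbb{F}_q$ be a finite field with $q$ odd, $n\ge 1$, $a_1,\dots,a_n\in\mathbb{F}_q^*$ and $b\in\mathbb{F}_q$. Let $$f(x_1,\dots,x_n)=\sum_{j=1}^n a_j x_1^{d_{1,j}}\cdots x_j^{d_{j,j}}-b\in\mathbb{F}_q[x_1,\dots,x_n]$$ be a fully triangular polynomial (that is, $d_{i,j}>0$ for all $1\le i\le j\le n$) that is totally $*$-equivalent to the quadratic diagonal polynomial $g(x_1,\dots,x_n)=a_1x_1^2+\dots+a_nx_n^2-b$. Let $\eta$ be the quadratic character of $\mathbb{F}_q$, and for $1\le k\le n$ let $r(k)=\#\{1\le j\le k:\eta(a_j)=1\}$, $s(k)=\#\{1\le j\le k:\eta(a_j)=-1\}$, $r=r(n)$, $s=s(n)$. Let $\zeta_1=(q(-1)^{(q-1)/2})^{1/2}-1$ and $\zeta_2=-(q(-1)^{(q-1)/2})^{1/2}-1$. Then the number $N(f)$ of roots of $f$ in $\mathbb{F}_q^n$ is as follows. a) If $b\ne0$, then $$\begin{aligned}N(f)=\;& q^{n-2}(q-1)-\frac{1}{2q}(\zeta_1^{r}\zeta_2^{s}+\zeta_2^{r}\zeta_1^{s})+\frac{\eta(b)}{2(q(-1)^{(q-1)/2})^{1/2}}(\zeta_1^{r}\zeta_2^{s}-\zeta_2^{r}\zeta_1^{s})\\&+\sum_{k=1}^{n-1}q^{n-k-1}\left(-\frac{1}{2q}(\zeta_1^{r(k)}\zeta_2^{s(k)}+\zeta_2^{r(k)}\zeta_1^{s(k)})+\frac{\eta(b)}{2(q(-1)^{(q-1)/2})^{1/2}}(\zeta_1^{r(k)}\zeta_2^{s(k)}-\zeta_2^{r(k)}\zeta_1^{s(k)})\right).\end{aligned}$$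 b) If $b=0$, then $$\begin{aligned}N(f)=\;& q^{n-1}+q^{n-2}(q-1)+\frac{q-1}{2q}(\zeta_1^{r}\zeta_2^{s}+\zeta_2^{r}\zeta_1^{s})\\&+\frac{q-1}{2}\sum_{k=1}^{n-1}q^{n-k-2}(\zeta_1^{r(k)}\zeta_2^{s(k)}+\zeta_2^{r(k)}\zeta_1^{s(k)}).\end{aligned}$$
   Context: The symbol $(q(-1)^{(q-1)/2})^{1/2}$ denotes a fixed complex square root of $q(-1)^{(q-1)/2}$, the same one in all occurrences. Formulas are identities of complex numbers. For a polynomial $f=\sum_{j=1}^m a_jX^{D_j}\in\mathbb{F}_q[x_1,\dots,x_n]$ with all $a_j\neq 0$, $D_j=(d_{1j},\dots,d_{nj})\in\mathbb{Z}_{\ge0}^n$ and $X^{D_j}=x_1^{d_{1j}}\cdots x_n^{d_{nj}}$, the augmented degree matrix $\tilde D_f$ is the $(n+1)\times m$ matrix whose $j$-th column is $(1,d_{1j},\dots,d_{nj})^T$. The vector $(a_1,\dots,a_m)$ is the coefficient vector. A triangular polynomial is one of the form $\sum_{j=1}^n a_jX^{D_j}-b$ with $a_1,\dots,a_n\in\mathbb{F}_q^*$, $b\in\mathbb{F}_q$, $D_j=(d_{1,j},\dots,d_{j,j},0,\dots,0)$, $d_{j,j}>0$ for all $j$ and $d_{i,j}\ge 0$ for $i<j$. Its monomials are ordered $X^{D_1},\dots,X^{D_n}$, followed, only if $b\ne0$, by the constant term with coefficient $-b$ and column $(1,0,\dots,0)^T$. Two polynomials $f,g$ are $*$-equivalent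 if they have the same coefficient vector and the congruence systems $\tilde D_f v^T\equiv 0\pmod{q-1}$ and $\tilde D_g v^T\equiv 0\pmod{q-1}$ have the same set of solutions $v$. For $1\le k\le n$ let $f_k(x_1,\dots,x_k)=f(x_1,\dots,x_k,0,\dots,0)\in\mathbb{F}_q[x_1,\dots,x_k]$. Polynomials $f,g\in\mathbb{F}_q[x_1,\dots,x_n]$ are totally $*$-equivalent if $f_k$ is $*$-equivalent to $g_k$ for all $1\le k\le n$. *)

theory Defs
  imports
    "HOL-Library.Poly_Mapping"
    "HOL-Library.FuncSet"
    "HOL-Library.Cardinality"
    "HOL-Number_Theory.Cong"
    "Jordan_Normal_Form.Matrix"
begin

(* A polynomial maps exponent vectors to coefficients; both are finitely supported.
   The variables x_1, ..., x_n are the indices 1, ..., n. *)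
type_synonym 'a mpoly = "(nat \<Rightarrow>\<^sub>0 nat) \<Rightarrow>\<^sub>0 'a"

abbreviation mpoly_monom :: "'a::zero \<Rightarrow> (nat \<Rightarrow>\<^sub>0 nat) \<Rightarrow> 'a mpoly" where
  "mpoly_monom c D \<equiv> Poly_Mapping.single D c"

abbreviation mpoly_const :: "'a::zero \<Rightarrow> 'a mpoly" where
  "mpoly_const c \<equiv> mpoly_monom c 0"

abbreviation mpoly_var :: "nat \<Rightarrow> 'a::zero_neq_one mpoly" where
  "mpoly_var i \<equiv> mpoly_monom 1 (Poly_Mapping.single i 1)"

(* Substitute \<sigma> i for x_i, coefficients being moved into the target ring by \<iota>. *)
definition mpoly_subst :: "('a::zero \<Rightarrow> 'b::comm_semiring_1) \<Rightarrow> (nat \<Rightarrow> 'b) \<Rightarrow> 'a mpoly \<Rightarrow> 'b" where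
  "mpoly_subst \<iota> \<sigma> f = (\<Sum>D\<in>Poly_Mapping.keys f.
     \<iota> (Poly_Mapping.lookup f D) * (\<Prod>i\<in>Poly_Mapping.keys D. \<sigma> i ^ Poly_Mapping.lookup D i))"

definition num_roots :: "nat \<Rightarrow> 'a::{field,finite} mpoly \<Rightarrow> nat" where
  "num_roots n f = card {x \<in> {1..n} \<rightarrow>\<^sub>E UNIV. mpoly_subst id x f = 0}"

(* f(x_1, ..., x_k, 0, ..., 0) *)
definition truncate_vars :: "nat \<Rightarrow> 'a::comm_ring_1 mpoly \<Rightarrow> 'a mpoly" where
  "truncate_vars k f = mpoly_subst mpoly_const (\<lambda>i. if i \<le> k then mpoly_var i else 0) f"

(* Coefficient vectors and degree matrices depend on an ordering of the monomials. It is
   passed as the list Ds of the exponent vectors of the monomials of f, each occurring once. *)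
definition enumerates_monomials :: "(nat \<Rightarrow>\<^sub>0 nat) list \<Rightarrow> 'a::zero mpoly \<Rightarrow> bool" where
  "enumerates_monomials Ds f \<longleftrightarrow> distinct Ds \<and> set Ds = Poly_Mapping.keys f"

definition coeff_vector :: "'a::zero mpoly \<Rightarrow> (nat \<Rightarrow>\<^sub>0 nat) list \<Rightarrow> 'a vec" where
  "coeff_vector f Ds = vec (length Ds) (\<lambda>j. Poly_Mapping.lookup f (Ds ! j))"

definition augmented_degree_matrix :: "nat \<Rightarrow> (nat \<Rightarrow>\<^sub>0 nat) list \<Rightarrow> int mat" where
  "augmented_degree_matrix n Ds =
     mat (n + 1) (length Ds) (\<lambda>(i, j). if i = 0 then 1 else int (Poly_Mapping.lookup (Ds ! j) i))"

definition congruence_solutions :: "int \<Rightarrow> int mat \<Rightarrow> int vec set" where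
  "congruence_solutions M A =
     {v \<in> carrier_vec (dim_col A). \<forall>i<dim_row A. [(A *\<^sub>v v) $ i = 0] (mod M)}"

definition star_equivalent ::
  "nat \<Rightarrow> 'a::{field,finite} mpoly \<Rightarrow> (nat \<Rightarrow>\<^sub>0 nat) list \<Rightarrow> 'a mpoly \<Rightarrow> (nat \<Rightarrow>\<^sub>0 nat) list \<Rightarrow> bool" where
  "star_equivalent n f Ds g Es \<longleftrightarrow>
     coeff_vector f Ds = coeff_vector g Es \<and>
     congruence_solutions (int CARD('a) - 1) (augmented_degree_matrix n Ds) =
     congruence_solutions (int CARD('a) - 1) (augmented_degree_matrix n Es)"

(* The monomials of the truncations are ordered as they are in f and in g. *)
definition totally_star_equivalent ::
  "nat \<Rightarrow> 'a::{field,finite} mpoly \<Rightarrow> (nat \<Rightarrow>\<^sub>0 nat) list \<Rightarrow> 'a mpoly \<Rightarrow> (nat \<Rightarrow>\<^sub>0 nat) list \<Rightarrow> bool" where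
  "totally_star_equivalent n f Ds g Es \<longleftrightarrow>
     (\<forall>k\<in>{1..n}.
        let fk = truncate_vars k f; gk = truncate_vars k g
        in star_equivalent k
             fk (filter (\<lambda>D. D \<in> Poly_Mapping.keys fk) Ds)
             gk (filter (\<lambda>D. D \<in> Poly_Mapping.keys gk) Es))"

definition triangular_exponents :: "nat \<Rightarrow> (nat \<Rightarrow> nat \<Rightarrow>\<^sub>0 nat) \<Rightarrow> bool" where
  "triangular_exponents n D \<longleftrightarrow>
     (\<forall>j\<in>{1..n}. Poly_Mapping.keys (D j) \<subseteq> {1..j} \<and> Poly_Mapping.lookup (D j) j > 0)"

definition fully_triangular_exponents :: "nat \<Rightarrow> (nat \<Rightarrow> nat \<Rightarrow>\<^sub>0 nat) \<Rightarrow> bool" where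
  "fully_triangular_exponents n D \<longleftrightarrow>
     triangular_exponents n D \<and> (\<forall>j\<in>{1..n}. \<forall>i\<in>{1..j}. Poly_Mapping.lookup (D j) i > 0)"

definition triangular_poly ::
  "nat \<Rightarrow> (nat \<Rightarrow> 'a::comm_ring_1) \<Rightarrow> (nat \<Rightarrow> nat \<Rightarrow>\<^sub>0 nat) \<Rightarrow> 'a \<Rightarrow> 'a mpoly" where
  "triangular_poly n a D b = (\<Sum>j = 1..n. mpoly_monom (a j) (D j)) - mpoly_const b"

(* The order of the monomials of a triangular polynomial: the constant term comes last,
   and is absent if b = 0. *)
definition triangular_order ::
  "nat \<Rightarrow> (nat \<Rightarrow> nat \<Rightarrow>\<^sub>0 nat) \<Rightarrow> 'a::zero \<Rightarrow> (nat \<Rightarrow>\<^sub>0 nat) list" where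
  "triangular_order n D b = map D [1..<n + 1] @ (if b = 0 then [] else [0])"

definition quadratic_character :: "'a::field \<Rightarrow> complex" where
  "quadratic_character c = (if c = 0 then 0 else if \<exists>x. x\<^sup>2 = c then 1 else - 1)"

lemma triangular_exponents_distinct:
  assumes "triangular_exponents n D"
  shows "inj_on D {1..n}" "0 \<notin> D ` {1..n}"
proof -
  have *: "D i \<noteq> D j" if "i \<in> {1..n}" "j \<in> {1..n}" "i < j" for i j
  proof
    assume "D i = D j"
    then have "Poly_Mapping.lookup (D i) j > 0"
      using assms that unfolding triangular_exponents_def by metis
    then have "j \<in> Poly_Mapping.keys (D i)" by (simp add: in_keys_iff)
    then show False using assms that unfolding triangular_exponents_def by fastforce
  qed
  show "inj_on D {1..n}"
    by (rule inj_onI) (metis * linorder_neqE_nat)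
  show "0 \<notin> D ` {1..n}"
    using assms unfolding triangular_exponents_def by (metis imageE less_irrefl lookup_zero)
qed

lemma triangular_order_enumerates:
  fixes a :: "nat \<Rightarrow> 'a::comm_ring_1"
  assumes D: "triangular_exponents n D" and a: "\<And>j. j \<in> {1..n} \<Longrightarrow> a j \<noteq> 0"
  shows "enumerates_monomials (triangular_order n D b) (triangular_poly n a D b)"
proof -
  note dist = triangular_exponents_distinct[OF D]
  have up: "set [1..<n + 1] = {1..n}" by auto
  have lk: "Poly_Mapping.lookup (triangular_poly n a D b) E =
      (\<Sum>j = 1..n. if D j = E then a j else 0) - (if E = 0 then b else 0)" for E
    unfolding triangular_poly_def
    by (simp add: lookup_minus lookup_sum lookup_single when_def)
  have l1: "Poly_Mapping.lookup (triangular_poly n a D b) (D i) = a i" if i: "i \<in> {1..n}" for i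
  proof -
    have "(\<Sum>j = 1..n. if D j = D i then a j else 0) = (\<Sum>j = 1..n. if j = i then a j else 0)"
      using dist(1) i by (intro sum.cong) (auto dest: inj_onD)
    moreover have "D i \<noteq> 0" using dist(2) i by (metis imageI)
    ultimately show ?thesis using i by (simp add: lk)
  qed
  have l0: "(\<Sum>j = 1..n. if D j = E then a j else 0) = 0" if "E \<notin> D ` {1..n}" for E
    using that by (intro sum.neutral) auto
  have l2: "Poly_Mapping.lookup (triangular_poly n a D b) E = (if E = 0 then - b else 0)"
    if "E \<notin> D ` {1..n}" for E
    using l0[OF that] by (simp add: lk)
  have keys: "E \<in> Poly_Mapping.keys (triangular_poly n a D b) \<longleftrightarrow>
      E \<in> D ` {1..n} \<or> (E = 0 \<and> b \<noteq> 0)" for E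
  proof (cases "E \<in> D ` {1..n}")
    case True
    then obtain i where i: "i \<in> {1..n}" "E = D i" by blast
    show ?thesis unfolding in_keys_iff i(2) l1[OF i(1)] using a[OF i(1)] i(1) by blast
  next
    case False
    then show ?thesis unfolding in_keys_iff l2[OF False] by auto
  qed
  show ?thesis
    unfolding enumerates_monomials_def
  proof
    show "distinct (triangular_order n D b)"
      using dist unfolding triangular_order_def distinct_append distinct_map set_map up by auto
    show "set (triangular_order n D b) = Poly_Mapping.keys (triangular_poly n a D b)"
      unfolding set_eq_iff keys triangular_order_def set_append set_map up by auto
  qed
qed

lemma mpoly_var_power:
  "(mpoly_var i :: 'a::comm_ring_1 mpoly) ^ e = mpoly_monom 1 (Poly_Mapping.single i e)"
proof (induction e)
  case 0
  then show ?case by (simp only: power_0 single_zero single_one)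
next
  case (Suc e)
  have "(mpoly_var i :: 'a mpoly) ^ Suc e =
      mpoly_var i * mpoly_monom 1 (Poly_Mapping.single i e)"
    by (simp only: power_Suc Suc)
  also have "\<dots> = mpoly_monom 1 (Poly_Mapping.single i (Suc e))"
    by (simp add: mult_single flip: single_add)
  finally show ?case .
qed

lemma diagonal_as_triangular_poly:
  "(\<Sum>j = 1..n. mpoly_const (a j) * mpoly_var j ^ 2) - mpoly_const b =
   triangular_poly n a (\<lambda>j. Poly_Mapping.single j 2) b"
  unfolding triangular_poly_def mpoly_var_power by (simp add: mult_single)

lemma diagonal_triangular_exponents: "triangular_exponents n (\<lambda>j. Poly_Mapping.single j 2)"
  unfolding triangular_exponents_def by auto

lemma prod_mpoly_monom:
  "finite I \<Longrightarrow> (\<Prod>i\<in>I. mpoly_monom (1 :: 'a::comm_ring_1) (E i)) = mpoly_monom 1 (\<Sum>i\<in>I. E i)"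
  by (induction I rule: finite_induct) (simp_all add: mult_single)

lemma truncate_vars_eq:
  "truncate_vars k f =
   (\<Sum>D\<in>{D \<in> Poly_Mapping.keys f. Poly_Mapping.keys D \<subseteq> {..k}}.
      mpoly_monom (Poly_Mapping.lookup f D) D)"
proof -
  have pm: "(\<Sum>i\<in>Poly_Mapping.keys D. Poly_Mapping.single i (Poly_Mapping.lookup D i)) = D"
    for D :: "nat \<Rightarrow>\<^sub>0 nat"
    by (rule poly_mapping_eqI) (simp add: lookup_sum lookup_single when_def in_keys_iff)
  have *: "(\<Prod>i\<in>Poly_Mapping.keys D. (if i \<le> k then mpoly_var i else (0 :: 'a mpoly)) ^ Poly_Mapping.lookup D i) =
      (if Poly_Mapping.keys D \<subseteq> {..k} then mpoly_monom 1 D else 0)" for D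
  proof (cases "Poly_Mapping.keys D \<subseteq> {..k}")
    case True
    have "(\<Prod>i\<in>Poly_Mapping.keys D. (if i \<le> k then mpoly_var i else (0 :: 'a mpoly)) ^ Poly_Mapping.lookup D i) =
      (\<Prod>i\<in>Poly_Mapping.keys D. mpoly_monom 1 (Poly_Mapping.single i (Poly_Mapping.lookup D i)))"
      using True by (intro prod.cong refl) (auto simp: mpoly_var_power simp del: One_nat_def)
    then show ?thesis using True by (simp add: prod_mpoly_monom pm)
  next
    case False
    then obtain i where "i \<in> Poly_Mapping.keys D" "\<not> i \<le> k" by auto
    moreover from this have "(0 :: 'a mpoly) ^ Poly_Mapping.lookup D i = 0"
      by (intro zero_power) (simp add: in_keys_iff)
    ultimately have "(\<Prod>i\<in>Poly_Mapping.keys D. (if i \<le> k then mpoly_var i else (0 :: 'a mpoly)) ^ Poly_Mapping.lookup D i) = 0"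
      by (intro prod_zero) (auto intro!: bexI[of _ i])
    then show ?thesis using False by simp
  qed
  show ?thesis
    unfolding truncate_vars_def mpoly_subst_def *
    by (simp add: sum.inter_filter mult_single if_distrib cong: if_cong)
qed

lemma lookup_truncate_vars:
  "Poly_Mapping.lookup (truncate_vars k f) E =
   (if Poly_Mapping.keys E \<subseteq> {..k} then Poly_Mapping.lookup f E else 0)"
  unfolding truncate_vars_eq
  by (auto simp: lookup_sum lookup_single when_def sum.If_cases in_keys_iff)

lemma truncate_triangular_poly:
  assumes D: "triangular_exponents n D" and "k \<le> n"
  shows "truncate_vars k (triangular_poly n a D b) = triangular_poly k a D b"
proof (rule poly_mapping_eqI)
  fix E
  have lk: "Poly_Mapping.lookup (triangular_poly m a D b) E =
      (\<Sum>j = 1..m. if D j = E then a j else 0) - (if E = 0 then b else 0)" for m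
    unfolding triangular_poly_def
    by (simp add: lookup_minus lookup_sum lookup_single when_def)
  have in_k: "Poly_Mapping.keys (D j) \<subseteq> {..k}" if "j \<in> {1..k}" for j
    using D that \<open>k \<le> n\<close> unfolding triangular_exponents_def by fastforce
  have out_k: "\<not> Poly_Mapping.keys (D j) \<subseteq> {..k}" if "j \<in> {1..n}" "j \<notin> {1..k}" for j
  proof -
    have "j \<in> Poly_Mapping.keys (D j)"
      using D that(1) unfolding triangular_exponents_def in_keys_iff by auto
    then show ?thesis using that by auto
  qed
  show "Poly_Mapping.lookup (truncate_vars k (triangular_poly n a D b)) E =
      Poly_Mapping.lookup (triangular_poly k a D b) E"
  proof (cases "Poly_Mapping.keys E \<subseteq> {..k}")
    case True
    have "(\<Sum>j = 1..n. if D j = E then a j else 0) = (\<Sum>j = 1..k. if D j = E then a j else 0)"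
      using True out_k \<open>k \<le> n\<close> by (intro sum.mono_neutral_right) auto
    then show ?thesis using True by (simp add: lookup_truncate_vars lk)
  next
    case False
    have "(\<Sum>j = 1..k. if D j = E then a j else 0) = 0"
      using False in_k by (intro sum.neutral ballI) (metis (full_types))
    moreover have "E \<noteq> 0" using False by auto
    ultimately show ?thesis using False by (simp add: lookup_truncate_vars lk)
  qed
qed

lemma filter_triangular_order:
  fixes a :: "nat \<Rightarrow> 'a::comm_ring_1"
  assumes D: "triangular_exponents n D" and "k \<le> n"
    and a: "\<And>j. j \<in> {1..n} \<Longrightarrow> a j \<noteq> 0"
  shows "filter (\<lambda>E. E \<in> Poly_Mapping.keys (truncate_vars k (triangular_poly n a D b)))
           (triangular_order n D b) = triangular_order k D b"
proof -
  let ?K = "Poly_Mapping.keys (triangular_poly k a D b)"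
  have Dk: "triangular_exponents k D"
    using D \<open>k \<le> n\<close> unfolding triangular_exponents_def by auto
  have K: "?K = set (triangular_order k D b)"
    using triangular_order_enumerates[OF Dk, of a b] a \<open>k \<le> n\<close>
    unfolding enumerates_monomials_def by auto
  have up: "set [1..<k + 1] = {1..k}" by auto
  have split: "[1..<n + 1] = [1..<k + 1] @ [k + 1..<n + 1]"
    using \<open>k \<le> n\<close> by (metis add_le_mono1 le_add2 le_Suc_ex upt_add_eq_append)
  have out: "D j \<notin> ?K" if "j \<in> {k + 1..n}" for j
  proof
    assume "D j \<in> ?K"
    then have "D j \<in> D ` {1..k} \<or> D j = 0"
      unfolding K triangular_order_def set_append set_map up by (auto split: if_splits)
    then consider i where "i \<in> {1..k}" "D j = D i" | "D j = 0" by blast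
    then show False
    proof cases
      case 1
      then have "j = i"
        using triangular_exponents_distinct(1)[OF D] that \<open>k \<le> n\<close> by (auto dest: inj_onD)
      then show False using 1 that by auto
    next
      case 2
      then show False
        using triangular_exponents_distinct(2)[OF D] that by (auto simp: image_iff)
    qed
  qed
  have order: "triangular_order n D b =
      map D [1..<k + 1] @ map D [k + 1..<n + 1] @ (if b = 0 then [] else [0])"
    unfolding triangular_order_def split by simp
  have "filter (\<lambda>E. E \<in> ?K) (map D [k + 1..<n + 1]) = []"
    using out by (auto simp: filter_empty_conv simp del: upt_Suc)
  moreover have "filter (\<lambda>E. E \<in> ?K) (map D [1..<k + 1]) = map D [1..<k + 1]"
    unfolding K triangular_order_def by (intro filter_True) auto
  moreover have "filter (\<lambda>E. E \<in> ?K) (if b = 0 then [] else [0]) = (if b = 0 then [] else [0])"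
    unfolding K triangular_order_def by auto
  ultimately show ?thesis
    unfolding truncate_triangular_poly[OF D \<open>k \<le> n\<close>] order filter_append
    by (simp only: triangular_order_def append_Nil)
qed

end

theory Submission
  imports Defs "HOL-Algebra.Multiplicative_Group"
begin

text \<open>
  Sort the zeros of \<open>f\<close> by the first coordinate that vanishes. If this is the \<open>(k + 1)\<close>-st, then every
  later monomial vanishes, so what counts are the zeros of \<open>f\<^sub>k\<close> with all coordinates nonzero, each
  extended by \<open>n - k - 1\<close> free coordinates. On the torus \<open>(F\<^sub>q\<^sup>*)\<^sup>k\<close>, written additively through a
  primitive element, the number of zeros depends only on the coefficients and on the distribution of the
  values modulo \<open>q - 1\<close> of the linear map given by the augmented degree matrix. By Fourier inversion this
  distribution is determined by the solutions of the congruence system, so \<open>f\<^sub>k\<close> may be replaced by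
  \<open>g\<^sub>k\<close>. For the diagonal quadric the torus count follows by induction on \<open>k\<close> from the sum of
  \<open>\<eta>(c - a x\<^sup>2)\<close> over \<open>x\<close>, which is elementary because \<open>y\<^sup>2 - x\<^sup>2 = d\<close> factors.
\<close>

subsection \<open>The quadratic character\<close>

lemma card_field_gt_1: "CARD('a::{field,finite}) > 1"
  using card_mono[of UNIV "{0, 1 :: 'a}"] by simp

text \<open>The multiplicative group of a finite field is cyclic. The powers below the least period
  \<open>e\<close> are distinct and exhaust the nonzero elements, so counting gives \<open>e\<close>
  = q - 1.\<close>

lemma finite_field_primitive_element:
  obtains \<gamma> :: "'a::{field,finite}"
  where "\<gamma> \<noteq> 0" "\<gamma> ^ (CARD('a) - 1) = 1" "bij_betw (\<lambda>i. \<gamma> ^ i) {..<CARD('a) - 1} (UNIV - {0})"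
proof -
  \<comment> \<open>The theorem on generators of the unit group speaks of rings as records, so the
    type is packaged as one.\<close>
  define R :: "'a ring" where "R = \<lparr>carrier = UNIV, mult = (*), one = 1, zero = 0, add = (+)\<rparr>"
  have "\<exists>y. x + y = 0" for x :: 'a
    by (rule exI[of _ "- x"]) simp
  moreover have "\<exists>y. x * y = 1" if "x \<noteq> 0" for x :: 'a
    using that by (intro exI[of _ "inverse x"]) simp
  ultimately interpret R: field R
    unfolding R_def by unfold_locales (auto simp: algebra_simps Units_def)
  have carr: "carrier (mult_of R) = UNIV - {0}"
    by (simp add: R_def)
  have fin: "finite (carrier R)"
    by (simp add: R_def)
  have pow: "x [^]\<^bsub>R\<^esub> (i :: nat) = x ^ i" for x i
    by (induction i) (simp_all add: R_def nat_pow_def mult.commute)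
  obtain \<gamma> :: 'a where \<gamma>: "\<gamma> \<noteq> 0" "UNIV - {0} = range (\<lambda>i::nat. \<gamma> ^ i)"
  proof -
    from R.finite_field_mult_group_has_gen[OF fin] obtain \<gamma> :: 'a
      where g: "\<gamma> \<in> UNIV - {0}" "UNIV - {0} = {\<gamma> ^ i | i::nat. i \<in> UNIV}"
      unfolding carr pow by (rule bexE)
    show thesis
    proof (rule that)
      show "\<gamma> \<noteq> 0" using g(1) by simp
      show "UNIV - {0} = range (\<lambda>i::nat. \<gamma> ^ i)" by (subst g(2)) auto
    qed
  qed
  \<comment> \<open>Infinitely many exponents share finitely many values: two powers agree, so some
    positive exponent gives 1.\<close>
  have "\<not> inj (\<lambda>i::nat. \<gamma> ^ i)"
    using finite_imageD[of "\<lambda>i::nat. \<gamma> ^ i" UNIV] by auto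
  then obtain i j where ij: "i < j" "\<gamma> ^ i = \<gamma> ^ j"
    by (metis injI linorder_neqE_nat)
  then have "\<gamma> ^ (j - i) = 1"
    using \<gamma>(1) by (simp add: power_diff)
  then have ex: "\<exists>e>0. \<gamma> ^ e = 1"
    using ij(1) by (intro exI[of _ "j - i"]) auto
  define e where "e = (LEAST e. e > 0 \<and> \<gamma> ^ e = 1)"
  have e: "e > 0" "\<gamma> ^ e = 1"
    using LeastI_ex[OF ex] unfolding e_def by auto
  have e_min: "e \<le> i" if "i > 0" "\<gamma> ^ i = 1" for i
    unfolding e_def using that by (intro Least_le) auto
  have inj: "inj_on (\<lambda>i. \<gamma> ^ i) {..<e}"
  proof (rule linorder_inj_onI)
    fix i j assume "i < j" "j \<in> {..<e}"
    moreover from this have "\<gamma> ^ (j - i) \<noteq> 1"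
      using e_min[of "j - i"] by force
    ultimately show "\<gamma> ^ i \<noteq> \<gamma> ^ j"
      using \<gamma>(1) by (auto simp: power_diff)
  qed auto
  have "\<gamma> ^ i = \<gamma> ^ (i mod e)" for i
    by (metis e(2) mod_mult_div_eq mult_1_right power_add power_mult power_one)
  then have "range (\<lambda>i. \<gamma> ^ i) = (\<lambda>i. \<gamma> ^ i) ` {..<e}"
    using e(1) by (auto intro!: image_eqI[of _ _ "_ mod e"])
  with inj \<gamma>(2) have bij: "bij_betw (\<lambda>i. \<gamma> ^ i) {..<e} (UNIV - {0})"
    by (simp add: bij_betw_def)
  moreover from this have "e = CARD('a) - 1"
    by (auto dest: bij_betw_same_card)
  ultimately show thesis using that \<gamma>(1) e(2) by blast
qed

lemma quadratic_character_0 [simp]: "quadratic_character 0 = 0"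
  by (simp add: quadratic_character_def)

lemma quadratic_character_square [simp]: "x \<noteq> 0 \<Longrightarrow> quadratic_character (x\<^sup>2) = 1"
  by (auto simp: quadratic_character_def)

lemma quadratic_character_cases:
  "x \<noteq> 0 \<Longrightarrow> quadratic_character x = 1 \<or> quadratic_character x = - 1"
  by (auto simp: quadratic_character_def)

text \<open>The squares are exactly the even powers of a primitive element: exponents matter only
  modulo q - 1, which is even, so their parity is well defined.\<close>

lemma quadratic_character_generator_power:
  fixes \<gamma> :: "'a::{field,finite}"
  assumes odd: "odd CARD('a)" and \<gamma>: "\<gamma> \<noteq> 0" "\<gamma> ^ (CARD('a) - 1) = 1"
    and bij: "bij_betw (\<lambda>i. \<gamma> ^ i) {..<CARD('a) - 1} (UNIV - {0})"
  shows "quadratic_character (\<gamma> ^ i) = (- 1) ^ i"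
proof -
  define M where "M = CARD('a) - 1"
  have "CARD('a) > 1" by (rule card_field_gt_1)
  then have M: "M > 0" "even M"
    using odd by (auto simp: M_def)
  have red: "\<gamma> ^ k = \<gamma> ^ (k mod M)" for k
    by (metis M_def \<gamma>(2) mod_mult_div_eq mult_1_right power_add power_mult power_one)
  have "even i" if "x\<^sup>2 = \<gamma> ^ i" for x
  proof -
    have "x \<in> UNIV - {0}" using that \<gamma>(1) by auto
    then obtain k where "x = \<gamma> ^ k"
      using bij unfolding bij_betw_def by auto
    then have "\<gamma> ^ (2 * k mod M) = \<gamma> ^ (i mod M)"
      using that red by (metis mult.commute power_mult)
    then have "2 * k mod M = i mod M"
      using inj_onD[OF bij_betw_imp_inj_on[OF bij]] M(1) unfolding M_def by simp
    then show "even i" using M(2) by (metis dvd_mod_iff dvd_triv_left)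
  qed
  moreover have "\<exists>x. x\<^sup>2 = \<gamma> ^ i" if "even i"
    using that by (metis evenE mult.commute power_mult)
  ultimately show ?thesis
    using \<gamma>(1) by (cases "even i") (auto simp: quadratic_character_def)
qed

lemma quadratic_character_mult:
  fixes x y :: "'a::{field,finite}"
  assumes "odd CARD('a)"
  shows "quadratic_character (x * y) = quadratic_character x * quadratic_character y"
proof (cases "x = 0 \<or> y = 0")
  case False
  obtain \<gamma> :: 'a where \<gamma>: "\<gamma> \<noteq> 0" "\<gamma> ^ (CARD('a) - 1) = 1"
    "bij_betw (\<lambda>i. \<gamma> ^ i) {..<CARD('a) - 1} (UNIV - {0})"
    by (rule finite_field_primitive_element)
  with False obtain i j where "x = \<gamma> ^ i" "y = \<gamma> ^ j"
    unfolding bij_betw_def by blast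
  then show ?thesis
    using quadratic_character_generator_power[OF assms \<gamma>] by (metis power_add)
qed auto

text \<open>The power of a primitive element with exponent (q - 1)/2 squares to 1 without being 1,
  so it is -1.\<close>

lemma quadratic_character_minus_one:
  assumes odd: "odd CARD('a::{field,finite})"
  shows "quadratic_character (- 1 :: 'a) = (- 1) ^ ((CARD('a) - 1) div 2)"
proof -
  define M where "M = CARD('a) - 1"
  have "CARD('a) > 1" by (rule card_field_gt_1)
  then have M: "M > 0" "even M"
    using odd by (auto simp: M_def)
  obtain \<gamma> :: 'a where \<gamma>: "\<gamma> \<noteq> 0" "\<gamma> ^ (CARD('a) - 1) = 1"
    "bij_betw (\<lambda>i. \<gamma> ^ i) {..<CARD('a) - 1} (UNIV - {0})"
    by (rule finite_field_primitive_element)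
  have "(\<gamma> ^ (M div 2))\<^sup>2 = 1"
    using \<gamma>(2) M(2) by (simp add: M_def flip: power_mult)
  moreover have "\<gamma> ^ (M div 2) \<noteq> \<gamma> ^ 0"
    using \<gamma>(3) M unfolding bij_betw_def M_def[symmetric]
    by (auto dest!: inj_onD[of _ _ "M div 2" 0])
  ultimately have "\<gamma> ^ (M div 2) = - 1"
    by (simp add: power2_eq_1_iff)
  then show ?thesis
    using quadratic_character_generator_power[OF odd \<gamma>] unfolding M_def by metis
qed

text \<open>If 2 were 0, then -1 = 1 and the only square root of 1 would be 1 itself; the power of a
  primitive element with exponent (q - 1)/2 is another one.\<close>

lemma two_neq_zero_if_odd_card:
  assumes odd: "odd CARD('a::{field,finite})"
  shows "(2 :: 'a) \<noteq> 0"
proof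
  assume two: "(2 :: 'a) = 0"
  obtain \<gamma> :: 'a where \<gamma>: "\<gamma> \<noteq> 0" "\<gamma> ^ (CARD('a) - 1) = 1"
    "bij_betw (\<lambda>i. \<gamma> ^ i) {..<CARD('a) - 1} (UNIV - {0})"
    by (rule finite_field_primitive_element)
  have "- 1 = (1 :: 'a)" using two by (metis add_eq_0_iff one_add_one)
  have "CARD('a) > 1" by (rule card_field_gt_1)
  then have half: "(CARD('a) - 1) div 2 < CARD('a) - 1" "(CARD('a) - 1) div 2 > 0"
    using odd by auto presburger+
  have "(\<gamma> ^ ((CARD('a) - 1) div 2))\<^sup>2 = 1"
    using \<gamma>(2) odd by (simp flip: power_mult)
  then have "\<gamma> ^ ((CARD('a) - 1) div 2) = \<gamma> ^ 0"
    using \<open>- 1 = 1\<close> by (auto simp: power2_eq_1_iff)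
  then show False
    using inj_onD[OF bij_betw_imp_inj_on[OF \<gamma>(3)]] half by (metis less_irrefl less_trans lessThan_iff)
qed

section \<open>Square roots and character sums over quadratic polynomials\<close>

lemma card_square_roots:
  fixes u :: "'a::{field,finite}"
  assumes "odd CARD('a)"
  shows "of_nat (card {y. y\<^sup>2 = u}) = 1 + quadratic_character u"
proof (cases "\<exists>x. x\<^sup>2 = u")
  case True
  then obtain x where x: "x\<^sup>2 = u" by blast
  have "{y. y\<^sup>2 = u} = {x, - x}"
    unfolding x[symmetric] by (auto simp: power2_eq_iff)
  moreover have "x \<noteq> - x" if "x \<noteq> 0"
    using that two_neq_zero_if_odd_card[OF assms] by (metis add.left_neutral add_eq_0_iff mult_2 mult_eq_0_iff)
  ultimately show ?thesis
    using x by (cases "x = 0") (auto simp: quadratic_character_def)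
qed (auto simp: quadratic_character_def)

text \<open>The hyperbola y^2 - x^2 = d is counted twice: it has q - 1 points, parametrised by t = y
  - x, and \<open>1 + quadratic_character (x\<^sup>2 + d)\<close> points above each x.\<close>

lemma sum_quadratic_character_shifted_square:
  fixes d :: "'a::{field,finite}"
  assumes odd: "odd CARD('a)" and d: "d \<noteq> 0"
  shows "(\<Sum>x\<in>UNIV. quadratic_character (x\<^sup>2 + d)) = - 1"
proof -
  let ?H = "SIGMA x:UNIV. {y. y\<^sup>2 = x\<^sup>2 + d}"
  have two: "(2 :: 'a) \<noteq> 0" by (rule two_neq_zero_if_odd_card[OF odd])
  have "bij_betw (\<lambda>(x, y). y - x) ?H (UNIV - {0})"
  \<comment> \<open>The inverse map solves y - x = t and y + x = d / t for x and y.\<close>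
  proof (rule bij_betw_byWitness[where f' = "\<lambda>t. ((d / t - t) / 2, (d / t + t) / 2)"])
    have "((d / (y - x) - (y - x)) / 2, (d / (y - x) + (y - x)) / 2) = (x, y)"
      if "y\<^sup>2 = x\<^sup>2 + d" for x y
    proof -
      from that have *: "d = (y - x) * (y + x)" by (simp add: power2_eq_square algebra_simps)
      with d have "y - x \<noteq> 0" by auto
      then have "d / (y - x) = y + x" using * by simp
      then show ?thesis
        using two by (simp add: flip: mult_2_right)
    qed
    then show "\<forall>p\<in>?H. (\<lambda>t. ((d / t - t) / 2, (d / t + t) / 2)) (case p of (x, y) \<Rightarrow> y - x) = p"
      by auto
    show "\<forall>t\<in>UNIV - {0}. (case ((d / t - t) / 2, (d / t + t) / 2) of (x, y) \<Rightarrow> y - x) = t"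
      using two by (simp flip: diff_divide_distrib mult_2)
    show "(\<lambda>(x, y). y - x) ` ?H \<subseteq> UNIV - {0}" using d by auto
    have "((d / t + t) / 2)\<^sup>2 = ((d / t - t) / 2)\<^sup>2 + d" if t: "t \<noteq> 0" for t
    proof -
      have "((d / t + t) / 2 - (d / t - t) / 2) * ((d / t + t) / 2 + (d / t - t) / 2) = t * (d / t)"
        using two by (simp add: diff_divide_distrib[symmetric] add_divide_distrib[symmetric] mult_2 flip: mult_2_right)
      then show ?thesis
        using t by (simp add: power2_eq_square algebra_simps)
    qed
    then show "(\<lambda>t. ((d / t - t) / 2, (d / t + t) / 2)) ` (UNIV - {0}) \<subseteq> ?H"
      by auto
  qed
  then have "card ?H = CARD('a) - 1"
    by (simp add: bij_betw_same_card)
  moreover have "card ?H = (\<Sum>x\<in>UNIV. card {y. y\<^sup>2 = x\<^sup>2 + d})"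
    by (rule card_SigmaI) auto
  moreover have "of_nat (CARD('a) - 1) = (of_nat CARD('a) - 1 :: complex)"
    by (simp add: of_nat_diff)
  ultimately have "(\<Sum>x\<in>UNIV. of_nat (card {y. y\<^sup>2 = x\<^sup>2 + d})) = (of_nat CARD('a) - 1 :: complex)"
    by (metis of_nat_sum)
  then show ?thesis
    by (simp add: card_square_roots[OF odd] sum.distrib)
qed

text \<open>Factoring out -a leads to the sum over shifted squares with d = -c / a; leaving out x =
  0 removes the term \<open>quadratic_character c\<close>. For c = 0 every term equals
  \<open>quadratic_character (- a)\<close>.\<close>

lemma sum_quadratic_character_quadratic:
  fixes a c :: "'a::{field,finite}"
  assumes odd: "odd CARD('a)" and a: "a \<noteq> 0"
  shows "(\<Sum>x\<in>UNIV - {0}. quadratic_character (c - a * x\<^sup>2)) =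
    (if c = 0 then (of_nat CARD('a) - 1) * quadratic_character (- a)
     else - quadratic_character (- a) - quadratic_character c)"
proof -
  have "- a * (x\<^sup>2 + - c / a) = c - a * x\<^sup>2" for x
    using a by (simp add: right_diff_distrib)
  then have *: "quadratic_character (c - a * x\<^sup>2) =
      quadratic_character (- a) * quadratic_character (x\<^sup>2 + - c / a)" for x
    by (metis quadratic_character_mult[OF odd])
  show ?thesis
  proof (cases "c = 0")
    case True
    have "(\<Sum>x\<in>UNIV - {0}. quadratic_character (c - a * x\<^sup>2)) =
        (\<Sum>x\<in>UNIV - {0 :: 'a}. quadratic_character (- a))"
    proof (rule sum.cong)
      fix x :: 'a assume "x \<in> UNIV - {0}"
      then show "quadratic_character (c - a * x\<^sup>2) = quadratic_character (- a)"
        using *[of x] True by simp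
    qed simp
    then show ?thesis using True by (simp add: card_Diff_singleton of_nat_diff)
  next
    case False
    have "(\<Sum>x\<in>UNIV - {0}. quadratic_character (c - a * x\<^sup>2)) =
        (\<Sum>x\<in>UNIV. quadratic_character (c - a * x\<^sup>2)) - quadratic_character c"
      by (simp add: sum_diff1)
    also have "(\<Sum>x\<in>UNIV. quadratic_character (c - a * x\<^sup>2)) = - quadratic_character (- a)"
      unfolding * sum_distrib_left[symmetric]
      using sum_quadratic_character_shifted_square[OF odd, of "- c / a"] a False by simp
    finally show ?thesis using False by simp
  qed
qed

lemma card_nonzero_scaled_square_roots:
  fixes a c :: "'a::{field,finite}"
  assumes odd: "odd CARD('a)" and a: "a \<noteq> 0"
  shows "of_nat (card {x \<in> UNIV - {0}. a * x\<^sup>2 = c}) =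
    (if c = 0 then 0 else 1 + quadratic_character a * quadratic_character c)"
proof (cases "c = 0")
  case False
  have "{x \<in> UNIV - {0}. a * x\<^sup>2 = c} = {x. x\<^sup>2 = c / a}"
    using a False by (auto simp: field_simps)
  \<comment> \<open>Both sides are the character of the product of a and c; the factor at a^2 is
    1.\<close>
  moreover have "quadratic_character (a\<^sup>2) * quadratic_character (c / a) =
      quadratic_character a * quadratic_character c"
    unfolding quadratic_character_mult[OF odd, symmetric] using a by (simp add: power2_eq_square)
  ultimately show ?thesis using a False by (simp add: card_square_roots[OF odd])
qed (use a in auto)

subsection \<open>Diagonal quadrics on the torus\<close>

lemma of_nat_card_filter:
  "finite A \<Longrightarrow> of_nat (card {x \<in> A. P x}) = (\<Sum>x\<in>A. if P x then 1 else 0 :: 'b::semiring_1)"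
  by (simp add: sum.If_cases Int_def)

text \<open>Splits off one coordinate: the last one in the induction on the dimension of the torus,
  and later the scalar exponent \<open>u 0\<close>.\<close>

lemma card_PiE_insert_filter:
  assumes "finite I" "i \<notin> I" "\<And>j. finite (A j)"
  shows "card {x \<in> Pi\<^sub>E (insert i I) A. P x} = (\<Sum>t\<in>A i. card {x \<in> Pi\<^sub>E I A. P (x(i := t))})"
proof -
  have "card {x \<in> Pi\<^sub>E (insert i I) A. P x} = (\<Sum>x\<in>Pi\<^sub>E (insert i I) A. if P x then 1 else 0)"
    using assms of_nat_card_filter[of "Pi\<^sub>E (insert i I) A" P, where 'b = nat] by (simp add: finite_PiE)
  also have "\<dots> = (\<Sum>(t, x)\<in>A i \<times> Pi\<^sub>E I A. if P (x(i := t)) then 1 else 0)"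
    unfolding PiE_insert_eq
    using inj_combinator[OF assms(2), of A] by (subst sum.reindex) (auto simp: case_prod_unfold)
  also have "\<dots> = (\<Sum>t\<in>A i. card {x \<in> Pi\<^sub>E I A. P (x(i := t))})"
    using assms of_nat_card_filter[of "Pi\<^sub>E I A", where 'b = nat]
    by (simp add: sum.cartesian_product[symmetric] finite_PiE)
  finally show ?thesis .
qed

text \<open>The algebra of the induction step in \<open>card_torus_diagonal_quadric\<close>, at \<open>c = 0\<close> and at \<open>c \<noteq> 0\<close>:
  \<open>X\<close> is \<open>(q - 1) ^ k\<close>, \<open>\<epsilon>\<close> and \<open>\<eta>\<close> are the characters of the new coefficient and of \<open>c\<close>, and \<open>w / q\<close>
  is \<open>quadratic_character (- 1) / w\<close>.\<close>
lemma torus_step_zero: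
  fixes q :: complex
  assumes "q \<noteq> 0"
  shows "(q - 1) * (X / q - (P + Q) / (2 * q)) + (P - Q) / 2 * (q - 1) * \<epsilon> * (w / q) =
    (q - 1) * X / q + (1 / 2 - 1 / (2 * q)) * (P * (\<epsilon> * w - 1) + Q * (- \<epsilon> * w - 1))"
  using assms by (simp add: divide_simps) (simp add: algebra_simps)

lemma torus_step_nonzero:
  fixes q :: complex
  assumes "q \<noteq> 0" "w \<noteq> 0"
  shows "(q - 1) * (X / q - (P + Q) / (2 * q)) + (P + Q) / 2 * (1 + \<epsilon> * \<eta>)
      + (- ((P - Q) / 2 * \<epsilon> * (w / q)) - (P - Q) / (2 * w) * \<eta>) =
    (q - 1) * X / q + (0 - 1 / (2 * q)) * (P * (\<epsilon> * w - 1) + Q * (- \<epsilon> * w - 1))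
      + \<eta> / (2 * w) * (P * (\<epsilon> * w - 1) - Q * (- \<epsilon> * w - 1))"
  using assms by (simp add: divide_simps) (simp add: algebra_simps)

text \<open>If \<open>w\<close> is read as the quadratic Gauss sum, the factors of \<open>P\<close>
  and \<open>Q\<close> are the sums over nonzero x of an additive character at a x^2, for square and
  nonsquare frequencies. Only w^2 matters: replacing w by -w swaps \<open>P\<close> and
  \<open>Q\<close> and leaves the formula unchanged. The induction splits off the last
  coordinate.\<close>

lemma card_torus_diagonal_quadric:
  fixes a :: "nat \<Rightarrow> 'a::{field,finite}"
  assumes odd: "odd CARD('a)" and a: "\<And>j. j \<in> {1..k} \<Longrightarrow> a j \<noteq> 0"
    and w: "w\<^sup>2 = of_nat CARD('a) * (- 1) ^ ((CARD('a) - 1) div 2)"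
  defines "P \<equiv> \<Prod>j = 1..k. quadratic_character (a j) * w - 1"
    and "Q \<equiv> \<Prod>j = 1..k. - quadratic_character (a j) * w - 1"
  shows "of_nat (card {x \<in> {1..k} \<rightarrow>\<^sub>E UNIV - {0}. (\<Sum>j = 1..k. a j * (x j)\<^sup>2) = c}) =
    (of_nat CARD('a) - 1) ^ k / of_nat CARD('a)
    + ((if c = 0 then 1 / 2 else 0) - 1 / (2 * of_nat CARD('a))) * (P + Q)
    + quadratic_character c / (2 * w) * (P - Q)"
  using a unfolding P_def Q_def
proof (induction k arbitrary: c)
  case 0
  \<comment> \<open>The empty sum is 0. Both empty products are 1, so the right-hand side is 1 for c
    = 0 and 0 otherwise.\<close>
  have "{x \<in> {1..0} \<rightarrow>\<^sub>E UNIV - {0}. (\<Sum>j = 1..0. a j * (x j)\<^sup>2) = c} = (if c = 0 then {\<lambda>_. undefined} else {})"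
    by auto
  then show ?case by simp
next
  case (Suc k)
  define q :: complex where "q = of_nat CARD('a)"
  define e where "e = quadratic_character (- 1 :: 'a)"
  define \<epsilon> where "\<epsilon> = quadratic_character (a (Suc k))"
  define P where "P = (\<Prod>j = 1..k. quadratic_character (a j) * w - 1)"
  define Q where "Q = (\<Prod>j = 1..k. - quadratic_character (a j) * w - 1)"
  define N where "N c = card {x \<in> {1..k} \<rightarrow>\<^sub>E UNIV - {0}. (\<Sum>j = 1..k. a j * (x j)\<^sup>2) = c}" for c
  have ak: "a (Suc k) \<noteq> 0" using Suc.prems by auto
  have q0: "q \<noteq> 0" by (simp add: q_def)
  have w2: "w\<^sup>2 = q * e"
    using w by (simp add: q_def e_def quadratic_character_minus_one[OF odd])
  have e2: "e\<^sup>2 = 1"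
    using quadratic_character_cases[of "- 1 :: 'a"] by (auto simp: e_def power2_eq_1_iff)
  have w0: "w \<noteq> 0" using w2 q0 e2 by auto
  have minus: "quadratic_character (- a (Suc k)) = e * \<epsilon>"
    unfolding e_def \<epsilon>_def quadratic_character_mult[OF odd, symmetric] by simp
  have "of_nat (card {x \<in> {1..Suc k} \<rightarrow>\<^sub>E UNIV - {0}. (\<Sum>j = 1..Suc k. a j * (x j)\<^sup>2) = c}) =
      (\<Sum>t\<in>UNIV - {0}. of_nat (N (c - a (Suc k) * t\<^sup>2)) :: complex)"
  proof -
    have sum_upd: "(\<Sum>j = 1..Suc k. a j * ((x(Suc k := t)) j)\<^sup>2) = (\<Sum>j = 1..k. a j * (x j)\<^sup>2) + a (Suc k) * t\<^sup>2"
      for x t by simp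
    have ins: "{1..Suc k} = insert (Suc k) {1..k}" by auto
    have "card {x \<in> insert (Suc k) {1..k} \<rightarrow>\<^sub>E UNIV - {0}. (\<Sum>j = 1..Suc k. a j * (x j)\<^sup>2) = c} =
      (\<Sum>t\<in>UNIV - {0}. card {x \<in> {1..k} \<rightarrow>\<^sub>E UNIV - {0}.
        (\<Sum>j = 1..Suc k. a j * ((x(Suc k := t)) j)\<^sup>2) = c})"
      by (rule card_PiE_insert_filter) auto
    then have "card {x \<in> {1..Suc k} \<rightarrow>\<^sub>E UNIV - {0}. (\<Sum>j = 1..Suc k. a j * (x j)\<^sup>2) = c} =
      (\<Sum>t\<in>UNIV - {0}. N (c - a (Suc k) * t\<^sup>2))"
      unfolding ins[symmetric] sum_upd N_def by (simp only: eq_diff_eq)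
    then show ?thesis by (simp only: of_nat_sum)
  qed
  \<comment> \<open>By the induction hypothesis only three sums over the new coordinate are needed:
    of a constant, of the indicator that the remaining value is 0, and of the character of that
    value.\<close>
  also have "\<dots> = (\<Sum>t\<in>UNIV - {0}. (q - 1) ^ k / q - (P + Q) / (2 * q)
      + (P + Q) / 2 * (if a (Suc k) * t\<^sup>2 = c then 1 else 0)
      + (P - Q) / (2 * w) * quadratic_character (c - a (Suc k) * t\<^sup>2))"
  proof (intro sum.cong refl)
    fix t
    have "of_nat (N d) = (q - 1) ^ k / q + ((if d = 0 then 1 / 2 else 0) - 1 / (2 * q)) * (P + Q)
        + quadratic_character d / (2 * w) * (P - Q)" for d
      unfolding N_def q_def P_def Q_def by (rule Suc.IH) (use Suc.prems in auto)
    moreover have "c - a (Suc k) * t\<^sup>2 = 0 \<longleftrightarrow> a (Suc k) * t\<^sup>2 = c" by auto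
    ultimately show "of_nat (N (c - a (Suc k) * t\<^sup>2)) = (q - 1) ^ k / q - (P + Q) / (2 * q)
      + (P + Q) / 2 * (if a (Suc k) * t\<^sup>2 = c then 1 else 0)
      + (P - Q) / (2 * w) * quadratic_character (c - a (Suc k) * t\<^sup>2)"
      by (simp add: left_diff_distrib right_diff_distrib diff_divide_distrib mult.commute)
  qed
  also have "\<dots> = (q - 1) * ((q - 1) ^ k / q - (P + Q) / (2 * q))
      + (P + Q) / 2 * (if c = 0 then 0 else 1 + \<epsilon> * quadratic_character c)
      + (P - Q) / (2 * w) * (if c = 0 then (q - 1) * (e * \<epsilon>) else - (e * \<epsilon>) - quadratic_character c)"
  proof -
    have "(\<Sum>t\<in>UNIV - {0}. if a (Suc k) * t\<^sup>2 = c then 1 else 0) =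
        (if c = 0 then 0 else 1 + \<epsilon> * quadratic_character c)"
      using card_nonzero_scaled_square_roots[OF odd ak, of c]
      unfolding \<epsilon>_def of_nat_card_filter[OF finite] .
    moreover have "(\<Sum>t\<in>UNIV - {0}. quadratic_character (c - a (Suc k) * t\<^sup>2)) =
        (if c = 0 then (q - 1) * (e * \<epsilon>) else - (e * \<epsilon>) - quadratic_character c)"
      unfolding sum_quadratic_character_quadratic[OF odd ak, of c] minus q_def by simp
    moreover have "of_nat (card (UNIV - {0 :: 'a})) = q - 1"
      by (simp add: q_def card_Diff_singleton of_nat_diff)
    ultimately show ?thesis
      unfolding sum.distrib sum_distrib_left[symmetric] sum_constant by simp
  qed
  also have "\<dots> = (q - 1) ^ Suc k / q
    + ((if c = 0 then 1 / 2 else 0) - 1 / (2 * q)) * (P * (\<epsilon> * w - 1) + Q * (- \<epsilon> * w - 1))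
    + quadratic_character c / (2 * w) * (P * (\<epsilon> * w - 1) - Q * (- \<epsilon> * w - 1))"
  proof -
    \<comment> \<open>The character \<open>e\<close> of -1 disappears because w^2 = q e and e^2 = 1;
      this produces the new factor w.\<close>
    have ew: "e / w = w / q" using w2 e2 w0 q0 by (simp add: field_simps power2_eq_square)
    show ?thesis
    proof (cases "c = 0")
      case True
      have "(P - Q) / (2 * w) * ((q - 1) * (e * \<epsilon>)) = (P - Q) / 2 * (q - 1) * \<epsilon> * (e / w)"
        by simp
      then show ?thesis
        using True torus_step_zero[OF q0, of "(q - 1) ^ k" P Q \<epsilon> w] unfolding ew by simp
    next
      case False
      have "(P - Q) / (2 * w) * (- (e * \<epsilon>) - quadratic_character c) =
          - ((P - Q) / 2 * \<epsilon> * (e / w)) - (P - Q) / (2 * w) * quadratic_character c"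
        using w0 by (simp add: field_simps)
      then show ?thesis
        using False torus_step_nonzero[OF q0 w0, of "(q - 1) ^ k" P Q \<epsilon> "quadratic_character c"]
        unfolding ew by simp
    qed
  qed
  finally show ?case
    by (simp add: q_def P_def Q_def \<epsilon>_def)
qed

subsection \<open>Zeros on the torus and the congruence system\<close>

text \<open>The basic additive character modulo M, on integer arguments so that representatives need
  not be reduced.\<close>

definition exp_mod :: "nat \<Rightarrow> int \<Rightarrow> complex" where
  "exp_mod M x = cis (2 * pi * of_int x / of_nat M)"

lemma exp_mod_0 [simp]: "exp_mod M 0 = 1"
  by (simp add: exp_mod_def)

lemma exp_mod_add: "exp_mod M (x + y) = exp_mod M x * exp_mod M y"
  by (simp add: exp_mod_def cis_mult add_divide_distrib distrib_left)

lemma exp_mod_sum: "exp_mod M (\<Sum>i\<in>I. x i) = (\<Prod>i\<in>I. exp_mod M (x i))"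
  by (induction I rule: infinite_finite_induct) (simp_all add: exp_mod_add)

lemma exp_mod_power: "exp_mod M (int u * x) = exp_mod M x ^ u"
  by (induction u) (simp_all add: exp_mod_add distrib_right)

text \<open>Multiples of M are full turns. Conversely, x may be replaced by its residue below M, and
  the M-th roots of unity with such indices are distinct.\<close>

lemma exp_mod_eq_1_iff:
  assumes "M > 0"
  shows "exp_mod M x = 1 \<longleftrightarrow> int M dvd x"
proof -
  have multiple: "exp_mod M (int M * n) = 1" for n
    using assms cis_multiple_2pi[of "of_int n"] by (simp add: exp_mod_def mult.assoc)
  show ?thesis
  proof
    assume *: "exp_mod M x = 1"
    define k where "k = nat (x mod int M)"
    have k: "k < M" "int k = x mod int M"
      using assms by (auto simp: k_def nat_less_iff)
    have "exp_mod M x = exp_mod M (int M * (x div int M)) * exp_mod M (int k)"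
      unfolding exp_mod_add[symmetric] k by simp
    then have "cis (2 * pi * real k / real M) = cis (2 * pi * real 0 / real M)"
      using * multiple by (simp add: exp_mod_def)
    then have "k = 0"
      using bij_betw_imp_inj_on[OF bij_betw_roots_unity[OF assms]] k(1) assms
      by (blast dest: inj_onD)
    then show "int M dvd x" using k(2) by auto
  next
    assume "int M dvd x"
    then show "exp_mod M x = 1" using multiple by auto
  qed
qed

text \<open>Orthogonality of characters: off the multiples of M this is a geometric sum of an M-th
  root of unity other than 1.\<close>

lemma sum_exp_mod:
  assumes "M > 0"
  shows "(\<Sum>u<M. exp_mod M (int u * c)) = (if int M dvd c then of_nat M else 0)"
proof (cases "int M dvd c")
  case True
  then show ?thesis using exp_mod_eq_1_iff[OF assms, of c] by (simp add: exp_mod_power)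
next
  case False
  then have "exp_mod M c \<noteq> 1" using exp_mod_eq_1_iff[OF assms, of c] by simp
  moreover have "exp_mod M c ^ M = 1"
    using exp_mod_eq_1_iff[OF assms, of "int M * c"] by (simp flip: exp_mod_power)
  ultimately show ?thesis
    using False by (simp add: exp_mod_power geometric_sum)
qed

text \<open>Orthogonality in several coordinates: the sum factors into one sum for each
  coordinate.\<close>

lemma sum_PiE_exp_mod:
  assumes "finite I" "M > 0"
  shows "(\<Sum>u\<in>I \<rightarrow>\<^sub>E {..<M}. exp_mod M (\<Sum>i\<in>I. int (u i) * c i)) =
    (if \<forall>i\<in>I. int M dvd c i then of_nat M ^ card I else 0)"
proof -
  have "(\<Sum>u\<in>I \<rightarrow>\<^sub>E {..<M}. exp_mod M (\<Sum>i\<in>I. int (u i) * c i)) =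
      (\<Prod>i\<in>I. \<Sum>t<M. exp_mod M (int t * c i))"
    unfolding exp_mod_sum using assms(1) by (subst prod_sum_PiE) auto
  also have "\<dots> = (if \<forall>i\<in>I. int M dvd c i then of_nat M ^ card I else 0)"
    using assms by (auto simp: sum_exp_mod intro: prod_zero)
  finally show ?thesis .
qed

text \<open>Fourier inversion on \<open>(\<int>/M)\<^sup>J\<close>: the distribution of the values of a linear map is determined
  by the kernel of its transpose.\<close>
lemma sum_linear_image_mod:
  fixes G :: "(nat \<Rightarrow> nat) \<Rightarrow> complex" and A :: "nat \<Rightarrow> nat \<Rightarrow> int"
  assumes I: "finite I" and J: "finite J" and M: "M > 0"
  defines "L \<equiv> \<lambda>u j. \<Sum>i\<in>I. int (u i) * A i j"
  defines "K \<equiv> {v \<in> J \<rightarrow>\<^sub>E {..<M}. \<forall>i\<in>I. int M dvd (\<Sum>j\<in>J. A i j * int (v j))}"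
  shows "of_nat M ^ card J * (\<Sum>u\<in>I \<rightarrow>\<^sub>E {..<M}. G (\<lambda>j\<in>J. nat (L u j mod int M))) =
    of_nat M ^ card I * (\<Sum>y\<in>J \<rightarrow>\<^sub>E {..<M}. G y * (\<Sum>v\<in>K. exp_mod M (- (\<Sum>j\<in>J. int (v j) * int (y j)))))"
proof -
  let ?V = "J \<rightarrow>\<^sub>E {..<M}" and ?U = "I \<rightarrow>\<^sub>E {..<M}"
  have fin: "finite ?V" using J by (simp add: finite_PiE)
  define e where "e v y = exp_mod M (- (\<Sum>j\<in>J. int (v j) * int (y j)))" for v y :: "nat \<Rightarrow> nat"
  define E where "E u v = exp_mod M (\<Sum>i\<in>I. int (u i) * (\<Sum>j\<in>J. A i j * int (v j)))" for u v :: "nat \<Rightarrow> nat"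
  \<comment> \<open>The condition that \<open>y\<close> is the reduced image of \<open>u\<close> is
    expanded by orthogonality into a sum over the frequencies \<open>v\<close>.\<close>
  have single: "of_nat M ^ card J * G (\<lambda>j\<in>J. nat (L u j mod int M)) =
      (\<Sum>y\<in>?V. \<Sum>v\<in>?V. G y * (e v y * E u v))" for u
  proof -
    define y\<^sub>u where "y\<^sub>u = (\<lambda>j\<in>J. nat (L u j mod int M))"
    have y_in: "y\<^sub>u \<in> ?V" using M by (auto simp: y\<^sub>u_def nat_less_iff)
    have eq: "(\<forall>j\<in>J. int M dvd L u j - int (y j)) \<longleftrightarrow> y = y\<^sub>u" if "y \<in> ?V" for y
    proof
      assume *: "\<forall>j\<in>J. int M dvd L u j - int (y j)"
      show "y = y\<^sub>u"
      proof (rule PiE_ext[OF that y_in])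
        fix j assume j: "j \<in> J"
        have "L u j mod int M = int (y j) mod int M"
          using * j by (simp add: mod_eq_dvd_iff)
        also have "\<dots> = int (y j)" using that j by (auto simp: PiE_iff)
        finally show "y j = y\<^sub>u j" using j by (simp add: y\<^sub>u_def)
      qed
    next
      assume "y = y\<^sub>u"
      then show "\<forall>j\<in>J. int M dvd L u j - int (y j)"
        using M by (simp add: y\<^sub>u_def minus_mod_eq_mult_div)
    qed
    \<comment> \<open>Interchanging the sums moves the linear map from \<open>u\<close> to
      \<open>v\<close>, which transposes it.\<close>
    have split: "exp_mod M (\<Sum>j\<in>J. int (v j) * (L u j - int (y j))) =
        e v y * E u v" for v y
    proof -
      have "(\<Sum>j\<in>J. int (v j) * L u j) = (\<Sum>i\<in>I. int (u i) * (\<Sum>j\<in>J. A i j * int (v j)))"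
        unfolding L_def sum_distrib_left by (subst sum.swap) (simp add: mult_ac)
      then have "(\<Sum>j\<in>J. int (v j) * (L u j - int (y j))) =
          - (\<Sum>j\<in>J. int (v j) * int (y j)) + (\<Sum>i\<in>I. int (u i) * (\<Sum>j\<in>J. A i j * int (v j)))"
        by (simp add: right_diff_distrib sum_subtractf)
      then show ?thesis by (simp only: e_def E_def exp_mod_add)
    qed
    have "(\<Sum>y\<in>?V. \<Sum>v\<in>?V. G y * (e v y * E u v)) =
        (\<Sum>y\<in>?V. if y = y\<^sub>u then G y * of_nat M ^ card J else 0)"
      unfolding split[symmetric] sum_distrib_left[symmetric] sum_PiE_exp_mod[OF J M]
      by (intro sum.cong) (simp_all add: eq)
    then show ?thesis using y_in fin by (simp add: y\<^sub>u_def[symmetric])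
  qed
  have "of_nat M ^ card J * (\<Sum>u\<in>?U. G (\<lambda>j\<in>J. nat (L u j mod int M))) =
      (\<Sum>y\<in>?V. \<Sum>v\<in>?V. \<Sum>u\<in>?U. G y * (e v y * E u v))"
    unfolding sum_distrib_left single
    by (rule trans[OF sum.swap], rule sum.cong[OF refl], rule sum.swap)
  \<comment> \<open>With the sum over \<open>u\<close> innermost, orthogonality in \<open>u\<close>
    keeps exactly the frequencies in the kernel \<open>K\<close>.\<close>
  also have "\<dots> = (\<Sum>y\<in>?V. \<Sum>v\<in>?V. if v \<in> K then of_nat M ^ card I * (G y * e v y) else 0)"
  proof (intro sum.cong refl)
    fix y v assume "v \<in> ?V"
    then show "(\<Sum>u\<in>?U. G y * (e v y * E u v)) = (if v \<in> K then of_nat M ^ card I * (G y * e v y) else 0)"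
      unfolding sum_distrib_left[symmetric] E_def sum_PiE_exp_mod[OF I M] by (auto simp: K_def)
  qed
  also have "\<dots> = (\<Sum>y\<in>?V. \<Sum>v\<in>K. of_nat M ^ card I * (G y * e v y))"
  proof -
    have "?V \<inter> K = K" by (auto simp: K_def)
    then show ?thesis using fin by (simp add: sum.inter_restrict[symmetric])
  qed
  finally show ?thesis by (simp add: e_def sum_distrib_left)
qed

section \<open>Torus zeros in exponent coordinates\<close>

lemma bij_betw_PiE_compose:
  assumes h: "bij_betw h A B"
  shows "bij_betw (\<lambda>u. \<lambda>i\<in>I. h (u i)) (I \<rightarrow>\<^sub>E A) (I \<rightarrow>\<^sub>E B)"
proof (rule bij_betw_byWitness[where f' = "\<lambda>x. \<lambda>i\<in>I. inv_into A h (x i)"])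
  note inv = bij_betw_inv_into_left[OF h] bij_betw_inv_into_right[OF h]
  show "\<forall>u\<in>I \<rightarrow>\<^sub>E A. (\<lambda>i\<in>I. inv_into A h ((\<lambda>i\<in>I. h (u i)) i)) = u"
    by (auto simp: fun_eq_iff inv PiE_iff extensional_def)
  show "\<forall>x\<in>I \<rightarrow>\<^sub>E B. (\<lambda>i\<in>I. h ((\<lambda>i\<in>I. inv_into A h (x i)) i)) = x"
    by (auto simp: fun_eq_iff inv PiE_iff extensional_def)
  show "(\<lambda>u. \<lambda>i\<in>I. h (u i)) ` (I \<rightarrow>\<^sub>E A) \<subseteq> I \<rightarrow>\<^sub>E B"
    using bij_betwE[OF h] by (auto simp: PiE_iff)
  show "(\<lambda>x. \<lambda>i\<in>I. inv_into A h (x i)) ` (I \<rightarrow>\<^sub>E B) \<subseteq> I \<rightarrow>\<^sub>E A"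
    using bij_betwE[OF bij_betw_inv_into[OF h]] by (auto simp: PiE_iff)
qed

text \<open>Multiplying the polynomial by a nonzero scalar \<open>\<gamma> ^ u 0\<close> does not change its zeros; this accounts
  for the row of ones of the augmented degree matrix.\<close>
lemma card_torus_zeros_exponents:
  fixes c :: "nat \<Rightarrow> 'a::{field,finite}" and d :: "nat \<Rightarrow> nat \<Rightarrow> nat"
  assumes \<gamma>: "\<gamma> \<noteq> 0" and bij: "bij_betw (\<lambda>i. \<gamma> ^ i) {..<M} (UNIV - {0})"
  shows "M * card {x \<in> {1..k} \<rightarrow>\<^sub>E UNIV - {0}. (\<Sum>j\<in>J. c j * (\<Prod>i = 1..k. x i ^ d i j)) = 0} =
    card {u \<in> {0..k} \<rightarrow>\<^sub>E {..<M}.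
      (\<Sum>j\<in>J. c j * \<gamma> ^ (\<Sum>i = 0..k. u i * (if i = 0 then 1 else d i j))) = 0}"
proof -
  let ?P = "\<lambda>u. (\<Sum>j\<in>J. c j * \<gamma> ^ (\<Sum>i = 0..k. u i * (if i = 0 then 1 else d i j))) = 0"
  let ?R = "\<lambda>x. (\<Sum>j\<in>J. c j * (\<Prod>i = 1..k. x i ^ d i j)) = 0"
  have ins: "{0..k} = insert 0 {1..k}" by auto
  have P: "?P (u(0 := t)) \<longleftrightarrow> ?R (\<lambda>i\<in>{1..k}. \<gamma> ^ u i)" for u t
  proof -
    have "\<gamma> ^ (\<Sum>i = 0..k. (u(0 := t)) i * (if i = 0 then 1 else d i j)) =
        \<gamma> ^ t * (\<Prod>i = 1..k. (\<lambda>i\<in>{1..k}. \<gamma> ^ u i) i ^ d i j)" for j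
    proof -
      have "(\<Sum>i = 0..k. (u(0 := t)) i * (if i = 0 then 1 else d i j)) = t + (\<Sum>i = 1..k. u i * d i j)"
        unfolding ins by simp
      then show ?thesis by (simp add: power_add power_sum power_mult)
    qed
    then have "(\<Sum>j\<in>J. c j * \<gamma> ^ (\<Sum>i = 0..k. (u(0 := t)) i * (if i = 0 then 1 else d i j))) =
        \<gamma> ^ t * (\<Sum>j\<in>J. c j * (\<Prod>i = 1..k. (\<lambda>i\<in>{1..k}. \<gamma> ^ u i) i ^ d i j))"
      by (simp only: sum_distrib_left mult_ac)
    then show ?thesis using \<gamma> by simp
  qed
  have "card {u \<in> {0..k} \<rightarrow>\<^sub>E {..<M}. ?P u} = (\<Sum>t<M. card {u \<in> {1..k} \<rightarrow>\<^sub>E {..<M}. ?P (u(0 := t))})"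
    unfolding ins by (rule card_PiE_insert_filter) auto
  also have "\<dots> = M * card {u \<in> {1..k} \<rightarrow>\<^sub>E {..<M}. ?R (\<lambda>i\<in>{1..k}. \<gamma> ^ u i)}"
    unfolding P by simp
  also have "card {u \<in> {1..k} \<rightarrow>\<^sub>E {..<M}. ?R (\<lambda>i\<in>{1..k}. \<gamma> ^ u i)} = card {x \<in> {1..k} \<rightarrow>\<^sub>E UNIV - {0}. ?R x}"
  proof (rule bij_betw_same_card)
    show "bij_betw (\<lambda>u. \<lambda>i\<in>{1..k}. \<gamma> ^ u i) {u \<in> {1..k} \<rightarrow>\<^sub>E {..<M}. ?R (\<lambda>i\<in>{1..k}. \<gamma> ^ u i)}
        {x \<in> {1..k} \<rightarrow>\<^sub>E UNIV - {0}. ?R x}"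
      using bij_betw_PiE_compose[OF bij, of "{1..k}"] unfolding bij_betw_def
      by (auto simp del: restrict_apply intro: inj_on_subset)
  qed
  finally show ?thesis by simp
qed

text \<open>Up to powers of M, the count is a Fourier sum in which the exponents enter only through
  the kernel \<open>K d\<close>, so equal kernels give equal counts.\<close>

lemma card_torus_zeros_cong:
  fixes c :: "nat \<Rightarrow> 'a::{field,finite}" and d d' :: "nat \<Rightarrow> nat \<Rightarrow> nat" and k :: nat
  assumes J: "finite J"
  defines "K \<equiv> \<lambda>d. {v \<in> J \<rightarrow>\<^sub>E {..<CARD('a) - 1}. \<forall>i\<in>{0..k}.
    int (CARD('a) - 1) dvd (\<Sum>j\<in>J. (if i = 0 then 1 else int (d i j)) * int (v j))}"
  assumes K: "K d = K d'"
  shows "card {x \<in> {1..k} \<rightarrow>\<^sub>E UNIV - {0}. (\<Sum>j\<in>J. c j * (\<Prod>i = 1..k. x i ^ d i j)) = 0} =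
    card {x \<in> {1..k} \<rightarrow>\<^sub>E UNIV - {0}. (\<Sum>j\<in>J. c j * (\<Prod>i = 1..k. x i ^ d' i j)) = 0}"
proof -
  define M where "M = CARD('a) - 1"
  have "CARD('a) > 1" by (rule card_field_gt_1)
  then have M: "M > 0" by (simp add: M_def)
  obtain \<gamma> :: 'a where \<gamma>: "\<gamma> \<noteq> 0" "\<gamma> ^ M = 1" "bij_betw (\<lambda>i. \<gamma> ^ i) {..<M} (UNIV - {0})"
    unfolding M_def by (rule finite_field_primitive_element)
  have red: "\<gamma> ^ k = \<gamma> ^ (k mod M)" for k
    by (metis \<gamma>(2) mod_mult_div_eq mult_1_right power_add power_mult power_one)
  \<comment> \<open>\<open>G\<close> records whether the sum vanishes when the j-th monomial takes
    the value \<open>\<gamma> ^ y j\<close>.\<close>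
  define G where "G y = (if (\<Sum>j\<in>J. c j * \<gamma> ^ y j) = 0 then 1 else 0 :: complex)" for y
  define N where "N d = card {x \<in> {1..k} \<rightarrow>\<^sub>E UNIV - {0}. (\<Sum>j\<in>J. c j * (\<Prod>i = 1..k. x i ^ d i j)) = 0}"
    for d :: "nat \<Rightarrow> nat \<Rightarrow> nat"
  have count: "of_nat M ^ card J * of_nat (M * N d) =
      of_nat M ^ card {0..k} *
      (\<Sum>y\<in>J \<rightarrow>\<^sub>E {..<M}. G y * (\<Sum>v\<in>K d. exp_mod M (- (\<Sum>j\<in>J. int (v j) * int (y j)))))" for d
  proof -
    let ?A = "\<lambda>i j. if i = 0 then 1 else d i j"
    have "of_nat (M * N d) =
        (\<Sum>u\<in>{0..k} \<rightarrow>\<^sub>E {..<M}. G (\<lambda>j. \<Sum>i = 0..k. u i * ?A i j))"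
      unfolding N_def card_torus_zeros_exponents[OF \<gamma>(1,3)] G_def
      by (rule of_nat_card_filter) (simp add: finite_PiE)
    \<comment> \<open>Since \<open>\<gamma> ^ M = 1\<close>, the exponents may be reduced modulo
      M.\<close>
    also have "\<dots> = (\<Sum>u\<in>{0..k} \<rightarrow>\<^sub>E {..<M}.
        G (\<lambda>j\<in>J. nat ((\<Sum>i = 0..k. int (u i) * int (?A i j)) mod int M)))"
    proof (intro sum.cong refl)
      fix u :: "nat \<Rightarrow> nat"
      have "nat ((\<Sum>i = 0..k. int (u i) * int (?A i j)) mod int M) = (\<Sum>i = 0..k. u i * ?A i j) mod M" for j
        by (simp only: nat_int flip: of_nat_mult of_nat_sum of_nat_mod)
      then have "(\<Sum>j\<in>J. c j * \<gamma> ^ (\<Sum>i = 0..k. u i * ?A i j)) =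
          (\<Sum>j\<in>J. c j * \<gamma> ^ (\<lambda>j\<in>J. nat ((\<Sum>i = 0..k. int (u i) * int (?A i j)) mod int M)) j)"
        by (intro sum.cong refl) (simp only: restrict_apply if_True red[symmetric])
      then show "G (\<lambda>j. \<Sum>i = 0..k. u i * ?A i j) =
          G (\<lambda>j\<in>J. nat ((\<Sum>i = 0..k. int (u i) * int (?A i j)) mod int M))"
        unfolding G_def by (simp only:)
    qed
    finally show ?thesis
      using sum_linear_image_mod[OF _ J M, of "{0..k}" G "\<lambda>i j. int (?A i j)"]
      unfolding K_def M_def[symmetric] by (simp add: if_distrib[of int] cong: if_cong)
  qed
  have "(of_nat M :: complex) ^ card J * of_nat (M * N d) = of_nat M ^ card J * of_nat (M * N d')"
    unfolding count K ..
  then show ?thesis using M by (simp add: N_def)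
qed

text \<open>Expresses the value through the data compared by \<open>star_equivalent\<close>.
  Extending each product from the keys to all of \<open>{1..k}\<close> only adds factors with
  exponent 0.\<close>

lemma mpoly_subst_enumerated:
  assumes Ds: "enumerates_monomials Ds f" and keys: "\<And>E. E \<in> set Ds \<Longrightarrow> Poly_Mapping.keys E \<subseteq> {1..k}"
  shows "mpoly_subst id x f =
    (\<Sum>j<length Ds. coeff_vector f Ds $ j * (\<Prod>i = 1..k. x i ^ Poly_Mapping.lookup (Ds ! j) i))"
proof -
  have "bij_betw ((!) Ds) {..<length Ds} (Poly_Mapping.keys f)"
    using Ds by (intro bij_betw_nth) (auto simp: enumerates_monomials_def)
  then have "mpoly_subst id x f = (\<Sum>j<length Ds. Poly_Mapping.lookup f (Ds ! j) *
      (\<Prod>i\<in>Poly_Mapping.keys (Ds ! j). x i ^ Poly_Mapping.lookup (Ds ! j) i))"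
    unfolding mpoly_subst_def id_def by (rule sum.reindex_bij_betw[symmetric])
  also have "\<dots> = (\<Sum>j<length Ds. coeff_vector f Ds $ j * (\<Prod>i = 1..k. x i ^ Poly_Mapping.lookup (Ds ! j) i))"
  proof (intro sum.cong refl arg_cong2[where f = "(*)"])
    fix j assume j: "j \<in> {..<length Ds}"
    then show "Poly_Mapping.lookup f (Ds ! j) = coeff_vector f Ds $ j"
      by (simp add: coeff_vector_def)
    show "(\<Prod>i\<in>Poly_Mapping.keys (Ds ! j). x i ^ Poly_Mapping.lookup (Ds ! j) i) =
        (\<Prod>i = 1..k. x i ^ Poly_Mapping.lookup (Ds ! j) i)"
      using keys[of "Ds ! j"] j by (intro prod.mono_neutral_left) (auto simp: in_keys_iff)
  qed
  finally show ?thesis .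
qed

text \<open>Brings the matrix condition into the divisibility form of
  \<open>card_torus_zeros_cong\<close>; row 0 is the row of ones.\<close>

lemma congruence_solutions_augmented_degree_matrix_iff:
  "vec (length Ds) (\<lambda>j. int (v j)) \<in> congruence_solutions M (augmented_degree_matrix k Ds) \<longleftrightarrow>
   (\<forall>i\<in>{0..k}. M dvd (\<Sum>j<length Ds.
      (if i = 0 then 1 else int (Poly_Mapping.lookup (Ds ! j) i)) * int (v j)))"
proof -
  let ?A = "augmented_degree_matrix k Ds" and ?v = "vec (length Ds) (\<lambda>j. int (v j))"
  have "(?A *\<^sub>v ?v) $ i = (\<Sum>j<length Ds.
      (if i = 0 then 1 else int (Poly_Mapping.lookup (Ds ! j) i)) * int (v j))" if "i \<le> k" for i
    using that unfolding augmented_degree_matrix_def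
    by (simp add: scalar_prod_def lessThan_atLeast0)
  then show ?thesis
    by (auto simp: congruence_solutions_def cong_0_iff less_Suc_eq_le augmented_degree_matrix_def)
qed

text \<open>The torus count sees a polynomial only through its coefficient vector and its congruence
  solutions, and these are shared.\<close>

lemma star_equivalent_card_torus_zeros:
  fixes f g :: "'a::{field,finite} mpoly"
  assumes star: "star_equivalent k f Ds g Es"
    and Ds: "enumerates_monomials Ds f" "\<And>E. E \<in> set Ds \<Longrightarrow> Poly_Mapping.keys E \<subseteq> {1..k}"
    and Es: "enumerates_monomials Es g" "\<And>E. E \<in> set Es \<Longrightarrow> Poly_Mapping.keys E \<subseteq> {1..k}"
  shows "card {x \<in> {1..k} \<rightarrow>\<^sub>E UNIV - {0}. mpoly_subst id x f = 0} =
    card {x \<in> {1..k} \<rightarrow>\<^sub>E UNIV - {0}. mpoly_subst id x g = 0}"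
proof -
  have coeff: "coeff_vector f Ds = coeff_vector g Es"
    and sol: "congruence_solutions (int CARD('a) - 1) (augmented_degree_matrix k Ds) =
      congruence_solutions (int CARD('a) - 1) (augmented_degree_matrix k Es)"
    using star by (auto simp: star_equivalent_def)
  \<comment> \<open>Vectors carry their dimension, so equal coefficient vectors mean equally many
    monomials and a common index set.\<close>
  have len: "length Es = length Ds"
    using arg_cong[OF coeff, of dim_vec] by (simp add: coeff_vector_def)
  have "CARD('a) > 0" by simp
  then have M: "int (CARD('a) - 1) = int CARD('a) - 1" by (simp add: of_nat_diff)
  have f_eq: "mpoly_subst id x f =
      (\<Sum>j<length Ds. coeff_vector f Ds $ j * (\<Prod>i = 1..k. x i ^ Poly_Mapping.lookup (Ds ! j) i))" for x
    by (rule mpoly_subst_enumerated[OF Ds])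
  have g_eq: "mpoly_subst id x g =
      (\<Sum>j<length Ds. coeff_vector f Ds $ j * (\<Prod>i = 1..k. x i ^ Poly_Mapping.lookup (Es ! j) i))" for x
    unfolding coeff len[symmetric] by (rule mpoly_subst_enumerated[OF Es])
  show ?thesis
    unfolding f_eq g_eq
  proof (rule card_torus_zeros_cong)
    show "{v \<in> {..<length Ds} \<rightarrow>\<^sub>E {..<CARD('a) - 1}. \<forall>i\<in>{0..k}. int (CARD('a) - 1) dvd
        (\<Sum>j<length Ds. (if i = 0 then 1 else int (Poly_Mapping.lookup (Ds ! j) i)) * int (v j))} =
      {v \<in> {..<length Ds} \<rightarrow>\<^sub>E {..<CARD('a) - 1}. \<forall>i\<in>{0..k}. int (CARD('a) - 1) dvd
        (\<Sum>j<length Ds. (if i = 0 then 1 else int (Poly_Mapping.lookup (Es ! j) i)) * int (v j))}"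
      using congruence_solutions_augmented_degree_matrix_iff[of Ds _ "int CARD('a) - 1" k]
        congruence_solutions_augmented_degree_matrix_iff[of Es _ "int CARD('a) - 1" k]
      unfolding M sol len by blast
  qed simp
qed

subsection \<open>Fully triangular polynomials\<close>

lemma mpoly_subst_triangular_poly:
  fixes a :: "nat \<Rightarrow> 'a::comm_ring_1"
  assumes D: "triangular_exponents n D"
  shows "mpoly_subst id x (triangular_poly n a D b) =
    (\<Sum>j = 1..n. a j * (\<Prod>i = 1..j. x i ^ Poly_Mapping.lookup (D j) i)) - b"
proof -
  define \<mu> where "\<mu> E = (\<Prod>i\<in>Poly_Mapping.keys E. x i ^ Poly_Mapping.lookup E i)" for E :: "nat \<Rightarrow>\<^sub>0 nat"
  \<comment> \<open>A superset of the keys that contains 0 in every case, so that b = 0 needs no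
    separate treatment.\<close>
  define S where "S = insert 0 (D ` {1..n})"
  have fin: "finite S" by (simp add: S_def)
  have lk: "Poly_Mapping.lookup (triangular_poly n a D b) E =
      (\<Sum>j = 1..n. if D j = E then a j else 0) - (if E = 0 then b else 0)" for E
    unfolding triangular_poly_def
    by (simp add: lookup_minus lookup_sum lookup_single when_def)
  have zero: "Poly_Mapping.lookup (triangular_poly n a D b) E = 0" if "E \<notin> S" for E
  proof -
    have "(\<Sum>j = 1..n. if D j = E then a j else 0) = 0"
      using that by (intro sum.neutral) (auto simp: S_def)
    then show ?thesis using that by (simp add: lk S_def)
  qed
  have "mpoly_subst id x (triangular_poly n a D b) =
      (\<Sum>E\<in>S. Poly_Mapping.lookup (triangular_poly n a D b) E * \<mu> E)"
    unfolding mpoly_subst_def \<mu>_def id_def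
    using fin zero by (intro sum.mono_neutral_left) (auto simp: in_keys_iff)
  also have "\<dots> = (\<Sum>E\<in>S. \<Sum>j = 1..n. if D j = E then a j * \<mu> E else 0) - (\<Sum>E\<in>S. if E = 0 then b * \<mu> E else 0)"
    by (simp add: lk left_diff_distrib sum_subtractf sum_distrib_right if_distrib[of "\<lambda>t. t * _"] cong: if_cong)
  also have "(\<Sum>E\<in>S. \<Sum>j = 1..n. if D j = E then a j * \<mu> E else 0) = (\<Sum>j = 1..n. a j * \<mu> (D j))"
    using fin by (subst sum.swap, intro sum.cong) (auto simp: S_def)
  also have "(\<Sum>E\<in>S. if E = 0 then b * \<mu> E else 0) = b"
    using fin by (simp add: S_def \<mu>_def)
  also have "(\<Sum>j = 1..n. a j * \<mu> (D j)) = (\<Sum>j = 1..n. a j * (\<Prod>i = 1..j. x i ^ Poly_Mapping.lookup (D j) i))"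
  proof (intro sum.cong refl arg_cong2[where f = "(*)"])
    fix j assume "j \<in> {1..n}"
    then have "Poly_Mapping.keys (D j) \<subseteq> {1..j}"
      using D by (simp add: triangular_exponents_def)
    then show "\<mu> (D j) = (\<Prod>i = 1..j. x i ^ Poly_Mapping.lookup (D j) i)"
      unfolding \<mu>_def by (intro prod.mono_neutral_left) (auto simp: in_keys_iff)
  qed
  finally show ?thesis .
qed

text \<open>Positivity of the exponents makes the variable with index k + 1 divide every monomial
  from that index on. Setting it to 0 leaves \<open>h k\<close> and frees all later
  coordinates.\<close>

lemma card_zeros_fully_triangular:
  fixes a :: "nat \<Rightarrow> 'a::{field,finite}" and b :: 'a and d :: "nat \<Rightarrow> nat \<Rightarrow> nat"
  assumes d: "\<And>i j. 1 \<le> i \<Longrightarrow> i \<le> j \<Longrightarrow> j \<le> n \<Longrightarrow> d i j > 0"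
  defines "h \<equiv> \<lambda>k x. \<Sum>j = 1..k. a j * (\<Prod>i = 1..j. x i ^ d i j)"
  defines "T \<equiv> \<lambda>k. card {x \<in> {1..k} \<rightarrow>\<^sub>E UNIV - {0}. h k x = b}"
  shows "card {x \<in> {1..n} \<rightarrow>\<^sub>E UNIV. h n x = b} = T n + (\<Sum>k<n. CARD('a) ^ (n - k - 1) * T k)"
proof -
  \<comment> \<open>Zeros that do not vanish in the first k coordinates. Passing from
    \<open>L k\<close> to \<open>L (Suc k)\<close> loses those whose first zero coordinate is
    \<open>Suc k\<close>, and these losses telescope.\<close>
  define L where "L k = {x \<in> {1..n} \<rightarrow>\<^sub>E UNIV. (\<forall>i\<in>{1..k}. x i \<noteq> 0) \<and> h n x = b}" for k
  have fin: "finite (L k)" for k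
    by (rule finite_subset[of _ "{1..n} \<rightarrow>\<^sub>E UNIV"]) (auto simp: L_def finite_PiE)
  have step: "card (L k) = card (L (Suc k)) + CARD('a) ^ (n - k - 1) * T k" if k: "k < n" for k
  proof -
    let ?Z = "{x \<in> L k. x (Suc k) = 0}"
    let ?S = "{x \<in> {1..k} \<rightarrow>\<^sub>E UNIV - {0}. h k x = b} \<times> ({Suc (Suc k)..n} \<rightarrow>\<^sub>E (UNIV :: 'a set))"
    have h_eq: "h n x = h k y" if x: "x (Suc k) = 0" and y: "\<And>i. i \<in> {1..k} \<Longrightarrow> y i = x i" for x y
    proof -
      have "(\<Prod>i = 1..j. x i ^ d i j) = 0" if j: "j \<in> {1..n} - {1..k}" for j
      proof (rule prod_zero)
        have "d (Suc k) j > 0" using j by (intro d) auto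
        then show "\<exists>i\<in>{1..j}. x i ^ d i j = 0"
          using j x by (intro bexI[of _ "Suc k"]) auto
      qed simp
      then have "h n x = h k x"
        unfolding h_def using k by (intro sum.mono_neutral_right) auto
      also have "\<dots> = h k y"
        unfolding h_def by (intro sum.cong prod.cong arg_cong2[where f = "(*)"] refl) (simp add: y)
      finally show ?thesis .
    qed
    \<comment> \<open>A lost zero is a torus zero \<open>y\<close> of \<open>h k\<close>, a 0 in
      position \<open>Suc k\<close>, and an arbitrary tail \<open>z\<close> of n - k - 1
      coordinates.\<close>
    have "bij_betw (\<lambda>(y, z) i. if i \<le> k then y i else if i = Suc k then 0 else z i) ?S ?Z"
    proof (rule bij_betw_byWitness[where f' = "\<lambda>x. (restrict x {1..k}, restrict x {Suc (Suc k)..n})"])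
      show "\<forall>p\<in>?S. (\<lambda>x. (restrict x {1..k}, restrict x {Suc (Suc k)..n}))
          (case p of (y, z) \<Rightarrow> \<lambda>i. if i \<le> k then y i else if i = Suc k then 0 else z i) = p"
        by (auto simp: fun_eq_iff PiE_iff extensional_def)
      show "\<forall>x\<in>?Z. (case (restrict x {1..k}, restrict x {Suc (Suc k)..n}) of
          (y, z) \<Rightarrow> \<lambda>i. if i \<le> k then y i else if i = Suc k then 0 else z i) = x"
        by (auto simp: fun_eq_iff PiE_iff extensional_def L_def)
      show "(\<lambda>(y, z) i. if i \<le> k then y i else if i = Suc k then 0 else z i) ` ?S \<subseteq> ?Z"
      proof (rule image_subsetI)
        fix p assume "p \<in> ?S"
        then obtain y z where p: "p = (y, z)" and y: "y \<in> {1..k} \<rightarrow>\<^sub>E UNIV - {0}" "h k y = b"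
          and z: "z \<in> {Suc (Suc k)..n} \<rightarrow>\<^sub>E UNIV"
          by auto
        let ?x = "\<lambda>i. if i \<le> k then y i else if i = Suc k then 0 else z i"
        have "h n ?x = h k y" by (rule h_eq) auto
        then have "?x \<in> ?Z"
          using y z k by (auto simp: L_def PiE_iff extensional_def)
        then show "(case p of (y, z) \<Rightarrow> \<lambda>i. if i \<le> k then y i else if i = Suc k then 0 else z i) \<in> ?Z"
          by (simp only: p prod.case)
      qed
      show "(\<lambda>x. (restrict x {1..k}, restrict x {Suc (Suc k)..n})) ` ?Z \<subseteq> ?S"
      proof (rule image_subsetI)
        fix x assume x: "x \<in> ?Z"
        have "h n x = h k (restrict x {1..k})" by (rule h_eq) (use x in auto)
        then show "(restrict x {1..k}, restrict x {Suc (Suc k)..n}) \<in> ?S"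
          using x by (auto simp: L_def)
      qed
    qed
    then have "card ?Z = T k * CARD('a) ^ (n - k - 1)"
      by (simp add: bij_betw_same_card[symmetric] card_cartesian_product card_PiE T_def)
    moreover have "L k = L (Suc k) \<union> ?Z"
      by (auto simp: L_def le_Suc_eq)
    moreover have "x (Suc k) \<noteq> 0" if "x \<in> L (Suc k)" for x
      using that by (simp add: L_def)
    then have "L (Suc k) \<inter> ?Z = {}" by auto
    ultimately show ?thesis
      using fin card_Un_disjoint[of "L (Suc k)" ?Z] by simp
  qed
  have telescope: "card (L 0) = card (L m) + (\<Sum>k<m. CARD('a) ^ (n - k - 1) * T k)" if "m \<le> n" for m
    using that by (induction m) (simp_all add: step)
  have "L 0 = {x \<in> {1..n} \<rightarrow>\<^sub>E UNIV. h n x = b}" by (simp add: L_def)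
  moreover have "L n = {x \<in> {1..n} \<rightarrow>\<^sub>E UNIV - {0}. h n x = b}" by (auto simp: L_def PiE_iff)
  ultimately show ?thesis using telescope[of n] by (simp add: T_def)
qed

text \<open>Factorisation of a difference of n-th powers of q and q - 1, whose difference is 1. It
  adds up the main terms of the torus counts.\<close>

lemma sum_powers_geometric:
  fixes q :: complex
  shows "(q - 1) ^ n + (\<Sum>k<n. q ^ (n - k - 1) * (q - 1) ^ k) = q ^ n"
proof (induction n)
  case (Suc n)
  have "(\<Sum>k<n. q ^ (Suc n - k - 1) * (q - 1) ^ k) = q * (\<Sum>k<n. q ^ (n - k - 1) * (q - 1) ^ k)"
    unfolding sum_distrib_left
    by (intro sum.cong refl) (simp add: Suc_diff_le Suc_diff_Suc flip: power_Suc)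
  then have "(q - 1) ^ Suc n + (\<Sum>k<Suc n. q ^ (Suc n - k - 1) * (q - 1) ^ k) =
      q * ((q - 1) ^ n + (\<Sum>k<n. q ^ (n - k - 1) * (q - 1) ^ k))"
    by (simp add: algebra_simps)
  then show ?case by (simp only: Suc.IH power_Suc)
qed simp

text \<open>Groups the factors by the sign of the character, which turns the products of the torus
  count into powers of the two zetas.\<close>

lemma prod_eq_power_card:
  fixes \<zeta>\<^sub>1 \<zeta>\<^sub>2 :: complex
  assumes "finite J" "\<And>j. j \<in> J \<Longrightarrow> \<eta> j = 1 \<and> f j = \<zeta>\<^sub>1 \<or> \<eta> j = (- 1 :: complex) \<and> f j = \<zeta>\<^sub>2"
  shows "(\<Prod>j\<in>J. f j) = \<zeta>\<^sub>1 ^ card {j \<in> J. \<eta> j = 1} * \<zeta>\<^sub>2 ^ card {j \<in> J. \<eta> j = - 1}"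
proof -
  have "J = {j \<in> J. \<eta> j = 1} \<union> {j \<in> J. \<eta> j = - 1}"
    using assms(2) by blast
  then have "(\<Prod>j\<in>J. f j) = (\<Prod>j\<in>{j \<in> J. \<eta> j = 1} \<union> {j \<in> J. \<eta> j = - 1}. f j)"
    by simp
  also have "\<dots> = (\<Prod>j\<in>{j \<in> J. \<eta> j = 1}. f j) * (\<Prod>j\<in>{j \<in> J. \<eta> j = - 1}. f j)"
    using assms(1) by (intro prod.union_disjoint) auto
  also have "(\<Prod>j\<in>{j \<in> J. \<eta> j = 1}. f j) = (\<Prod>j\<in>{j \<in> J. \<eta> j = 1}. \<zeta>\<^sub>1)"
    using assms(2) by (intro prod.cong) force+
  also have "(\<Prod>j\<in>{j \<in> J. \<eta> j = - 1}. f j) = (\<Prod>j\<in>{j \<in> J. \<eta> j = - 1}. \<zeta>\<^sub>2)"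
    using assms(2) by (intro prod.cong) force+
  finally show ?thesis by simp
qed

text \<open>Integer powers \<open>powi\<close> are used because the exponents n - 2 and n - k - 2
  can be -1.\<close>

theorem theorem14:
  fixes n q :: nat
    and a :: "nat \<Rightarrow> 'a::{field,finite}" and b :: 'a
    and D :: "nat \<Rightarrow> nat \<Rightarrow>\<^sub>0 nat"
    and f g :: "'a mpoly"
    and w \<zeta>\<^sub>1 \<zeta>\<^sub>2 :: complex
    and r s :: "nat \<Rightarrow> nat"
    and \<eta> :: "'a \<Rightarrow> complex"
  assumes q: "q = CARD('a)" "odd q"
    and n: "n \<ge> 1"
    and a: "\<And>j. j \<in> {1..n} \<Longrightarrow> a j \<noteq> 0"
    and D: "fully_triangular_exponents n D"
    and f: "f = triangular_poly n a D b"
    and g: "g = (\<Sum>j = 1..n. mpoly_const (a j) * mpoly_var j ^ 2) - mpoly_const b"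
    and equiv: "totally_star_equivalent n
                  f (triangular_order n D b)
                  g (triangular_order n (\<lambda>j. Poly_Mapping.single j 2) b)"
    and \<eta>: "\<eta> = quadratic_character"
    and r: "r = (\<lambda>k. card {j \<in> {1..k}. \<eta> (a j) = 1})"
    and s: "s = (\<lambda>k. card {j \<in> {1..k}. \<eta> (a j) = - 1})"
    and w: "w ^ 2 = of_nat q * (- 1) ^ ((q - 1) div 2)"
    and \<zeta>\<^sub>1: "\<zeta>\<^sub>1 = w - 1"
    and \<zeta>\<^sub>2: "\<zeta>\<^sub>2 = - w - 1"
  shows "(b \<noteq> 0 \<longrightarrow>
      of_nat (num_roots n f) =
        of_nat q powi (int n - 2) * (of_nat q - 1)
        - 1 / (2 * of_nat q) * (\<zeta>\<^sub>1 ^ r n * \<zeta>\<^sub>2 ^ s n + \<zeta>\<^sub>2 ^ r n * \<zeta>\<^sub>1 ^ s n)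
        + \<eta> b / (2 * w) * (\<zeta>\<^sub>1 ^ r n * \<zeta>\<^sub>2 ^ s n - \<zeta>\<^sub>2 ^ r n * \<zeta>\<^sub>1 ^ s n)
        + (\<Sum>k = 1..n - 1. of_nat q powi (int n - int k - 1) *
            (- (1 / (2 * of_nat q)) * (\<zeta>\<^sub>1 ^ r k * \<zeta>\<^sub>2 ^ s k + \<zeta>\<^sub>2 ^ r k * \<zeta>\<^sub>1 ^ s k)
             + \<eta> b / (2 * w) * (\<zeta>\<^sub>1 ^ r k * \<zeta>\<^sub>2 ^ s k - \<zeta>\<^sub>2 ^ r k * \<zeta>\<^sub>1 ^ s k))))
    \<and> (b = 0 \<longrightarrow>
      of_nat (num_roots n f) =
        of_nat q powi (int n - 1)
        + of_nat q powi (int n - 2) * (of_nat q - 1)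
        + (of_nat q - 1) / (2 * of_nat q) * (\<zeta>\<^sub>1 ^ r n * \<zeta>\<^sub>2 ^ s n + \<zeta>\<^sub>2 ^ r n * \<zeta>\<^sub>1 ^ s n)
        + (of_nat q - 1) / 2 * (\<Sum>k = 1..n - 1. of_nat q powi (int n - int k - 2) *
            (\<zeta>\<^sub>1 ^ r k * \<zeta>\<^sub>2 ^ s k + \<zeta>\<^sub>2 ^ r k * \<zeta>\<^sub>1 ^ s k)))"
proof -
  let ?sq = "\<lambda>j. Poly_Mapping.single j 2 :: nat \<Rightarrow>\<^sub>0 nat"
  define Q :: complex where "Q = of_nat q"
  define T where "T k = card {x \<in> {1..k} \<rightarrow>\<^sub>E UNIV - {0}.
    (\<Sum>j = 1..k. a j * (\<Prod>i = 1..j. x i ^ Poly_Mapping.lookup (D j) i)) = b}" for k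
  define S where "S k = card {x \<in> {1..k} \<rightarrow>\<^sub>E UNIV - {0}. (\<Sum>j = 1..k. a j * (x j)\<^sup>2) = b}" for k
  define P\<^sub>1 where "P\<^sub>1 k = \<zeta>\<^sub>1 ^ r k * \<zeta>\<^sub>2 ^ s k" for k
  define P\<^sub>2 where "P\<^sub>2 k = \<zeta>\<^sub>2 ^ r k * \<zeta>\<^sub>1 ^ s k" for k
  \<comment> \<open>\<open>\<alpha>\<close> and \<open>\<beta>\<close> are the coefficients of the
    sum and of the difference of the two products in the torus count at c = b.\<close>
  define \<alpha> where "\<alpha> = (if b = 0 then 1 / 2 else 0) - 1 / (2 * Q)"
  define \<beta> where "\<beta> = \<eta> b / (2 * w)"
  have tri: "triangular_exponents n D"
    using D by (simp add: fully_triangular_exponents_def)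
  have tri_le: "triangular_exponents k E" if "triangular_exponents n E" "k \<le> n" for k E
    using that by (simp add: triangular_exponents_def)
  have g': "g = triangular_poly n a ?sq b"
    unfolding g by (rule diagonal_as_triangular_poly)
  have "{j \<in> {1..0}. X j} = {}" for X :: "nat \<Rightarrow> bool" by auto
  then have P_0: "P\<^sub>1 0 = 1" "P\<^sub>2 0 = 1"
    unfolding P\<^sub>1_def P\<^sub>2_def r s by simp_all
  have Q0: "Q \<noteq> 0" unfolding Q_def q(1) by simp

  have T_eq_S: "T k = S k" if k: "k \<in> {1..n}" for k
  proof -
    have k_le: "k \<le> n" and ak: "\<And>j. j \<in> {1..k} \<Longrightarrow> a j \<noteq> 0" using k a by auto
    note trunc = truncate_triangular_poly[OF _ k_le]
    have filter: "filter (\<lambda>F. F \<in> Poly_Mapping.keys (truncate_vars k (triangular_poly n a E b)))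
        (triangular_order n E b) = triangular_order k E b" if "triangular_exponents n E" for E
      by (rule filter_triangular_order[OF that k_le]) (rule a)
    have star: "star_equivalent k (triangular_poly k a D b) (triangular_order k D b)
        (triangular_poly k a ?sq b) (triangular_order k ?sq b)"
    proof -
      \<comment> \<open>Truncation at k keeps the first k terms and the constant, in the inherited
        order, so both truncations are again triangular polynomials.\<close>
      from equiv k have "star_equivalent k
          (truncate_vars k f) (filter (\<lambda>E. E \<in> Poly_Mapping.keys (truncate_vars k f)) (triangular_order n D b))
          (truncate_vars k g) (filter (\<lambda>E. E \<in> Poly_Mapping.keys (truncate_vars k g)) (triangular_order n ?sq b))"
        unfolding totally_star_equivalent_def Let_def by blast
      then show ?thesis
        unfolding f g' filter[OF tri] filter[OF diagonal_triangular_exponents]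
        unfolding trunc[OF tri] trunc[OF diagonal_triangular_exponents] .
    qed
    have keys: "Poly_Mapping.keys F \<subseteq> {1..k}"
      if E: "triangular_exponents k E" and F: "F \<in> set (triangular_order k E b)" for E F
    proof -
      have "F = 0 \<or> (\<exists>j\<in>{1..k}. F = E j)"
        using F unfolding triangular_order_def by (auto split: if_splits)
      then show ?thesis
        using E unfolding triangular_exponents_def by fastforce
    qed
    have "(\<Prod>i = 1..j. x i ^ Poly_Mapping.lookup (?sq j) i) = (x j)\<^sup>2" if "j \<ge> 1" for x :: "nat \<Rightarrow> 'a" and j
    proof -
      have "(\<Prod>i = 1..j. x i ^ Poly_Mapping.lookup (?sq j) i) = (\<Prod>i = 1..j. if i = j then (x i)\<^sup>2 else 1)"
        by (intro prod.cong) (auto simp: lookup_single)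
      then show ?thesis using that by simp
    qed
    then have val: "mpoly_subst id x (triangular_poly k a ?sq b) = (\<Sum>j = 1..k. a j * (x j)\<^sup>2) - b" for x
      unfolding mpoly_subst_triangular_poly[OF diagonal_triangular_exponents]
      by (intro arg_cong2[where f = "(-)"] sum.cong refl) simp
    show ?thesis
      using star_equivalent_card_torus_zeros[OF star
          triangular_order_enumerates[OF tri_le[OF tri k_le] ak] keys[OF tri_le[OF tri k_le]]
          triangular_order_enumerates[OF diagonal_triangular_exponents ak] keys[OF diagonal_triangular_exponents]]
      by (simp add: val mpoly_subst_triangular_poly[OF tri_le[OF tri k_le]] T_def S_def)
  qed

  have S_eq: "of_nat (S k) = (Q - 1) ^ k / Q + \<alpha> * (P\<^sub>1 k + P\<^sub>2 k) + \<beta> * (P\<^sub>1 k - P\<^sub>2 k)" if k: "k \<le> n" for k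
  proof -
    have ak: "\<And>j. j \<in> {1..k} \<Longrightarrow> a j \<noteq> 0" using k a by auto
    have cases: "\<eta> (a j) = 1 \<and> \<eta> (a j) * w - 1 = \<zeta>\<^sub>1 \<or> \<eta> (a j) = - 1 \<and> \<eta> (a j) * w - 1 = \<zeta>\<^sub>2"
      "\<eta> (a j) = 1 \<and> - \<eta> (a j) * w - 1 = \<zeta>\<^sub>2 \<or> \<eta> (a j) = - 1 \<and> - \<eta> (a j) * w - 1 = \<zeta>\<^sub>1"
      if "j \<in> {1..k}" for j
      using quadratic_character_cases[OF ak[OF that]] unfolding \<eta> \<zeta>\<^sub>1 \<zeta>\<^sub>2 by (elim disjE; simp)+
    have "(\<Prod>j = 1..k. \<eta> (a j) * w - 1) = P\<^sub>1 k"
      unfolding P\<^sub>1_def r s by (rule prod_eq_power_card[OF finite_atLeastAtMost cases(1)])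
    moreover have "(\<Prod>j = 1..k. - \<eta> (a j) * w - 1) = P\<^sub>2 k"
      unfolding P\<^sub>2_def r s by (rule prod_eq_power_card[OF finite_atLeastAtMost cases(2)])
    ultimately show ?thesis
      using card_torus_diagonal_quadric[OF q(2)[unfolded q(1)] ak w[unfolded q(1)], where c = b]
      unfolding S_def \<alpha>_def \<beta>_def Q_def \<eta> q(1) by simp
  qed

  have "num_roots n f = card {x \<in> {1..n} \<rightarrow>\<^sub>E UNIV.
      (\<Sum>j = 1..n. a j * (\<Prod>i = 1..j. x i ^ Poly_Mapping.lookup (D j) i)) = b}"
    unfolding num_roots_def f mpoly_subst_triangular_poly[OF tri] by simp
  also have "\<dots> = T n + (\<Sum>k<n. q ^ (n - k - 1) * T k)"
    unfolding T_def q(1)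
    by (rule card_zeros_fully_triangular[of n "\<lambda>i j. Poly_Mapping.lookup (D j) i"])
      (use D in \<open>auto simp: fully_triangular_exponents_def\<close>)
  \<comment> \<open>The equivalence covers k from 1 on; for k = 0 both counts concern the same empty
    sum.\<close>
  also have "\<dots> = S n + (\<Sum>k<n. q ^ (n - k - 1) * S k)"
  proof -
    have "T k = S k" if "k \<le> n" for k
      using T_eq_S[of k] that by (cases "k = 0") (auto simp: T_def S_def)
    then show ?thesis by simp
  qed
  finally have "of_nat (num_roots n f) = of_nat (S n) + (\<Sum>k<n. Q ^ (n - k - 1) * of_nat (S k))"
    by (simp add: Q_def)
  also have "\<dots> = ((Q - 1) ^ n + (\<Sum>k<n. Q ^ (n - k - 1) * (Q - 1) ^ k)) / Q
      + \<alpha> * (P\<^sub>1 n + P\<^sub>2 n) + \<beta> * (P\<^sub>1 n - P\<^sub>2 n)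
      + (\<Sum>k<n. Q ^ (n - k - 1) * (\<alpha> * (P\<^sub>1 k + P\<^sub>2 k) + \<beta> * (P\<^sub>1 k - P\<^sub>2 k)))"
    by (simp add: S_eq distrib_left sum.distrib add_divide_distrib sum_divide_distrib)
  also have "(Q - 1) ^ n + (\<Sum>k<n. Q ^ (n - k - 1) * (Q - 1) ^ k) = Q ^ n"
    by (rule sum_powers_geometric)
  \<comment> \<open>The term k = 0, where both products are 1, is split off: it belongs to the main
    term of the final formula.\<close>
  also have "{..<n} = insert 0 {1..n - 1}" using n by auto
  also have "(\<Sum>k\<in>insert 0 {1..n - 1}. Q ^ (n - k - 1) * (\<alpha> * (P\<^sub>1 k + P\<^sub>2 k) + \<beta> * (P\<^sub>1 k - P\<^sub>2 k))) =
      Q ^ (n - 1) * (2 * \<alpha>) + (\<Sum>k = 1..n - 1. Q ^ (n - k - 1) * (\<alpha> * (P\<^sub>1 k + P\<^sub>2 k) + \<beta> * (P\<^sub>1 k - P\<^sub>2 k)))"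
    by (simp add: P_0)
  finally have N: "of_nat (num_roots n f) = Q ^ n / Q + \<alpha> * (P\<^sub>1 n + P\<^sub>2 n) + \<beta> * (P\<^sub>1 n - P\<^sub>2 n)
      + (Q ^ (n - 1) * (2 * \<alpha>)
      + (\<Sum>k = 1..n - 1. Q ^ (n - k - 1) * (\<alpha> * (P\<^sub>1 k + P\<^sub>2 k) + \<beta> * (P\<^sub>1 k - P\<^sub>2 k))))" .

  have powi1: "Q powi (int n - 1) = Q ^ (n - 1)"
    using n by (simp add: power_int_def nat_diff_distrib)
  have Qn: "Q ^ n = Q * Q ^ (n - 1)"
    using n by (simp add: power_eq_if)
  have powi2: "Q powi (int n - 2) = Q ^ (n - 1) / Q"
    using power_int_diff[of Q "int n - 1" 1] Q0 powi1 by simp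
  have powik1: "Q powi (int n - int k - 1) = Q ^ (n - k - 1)" if "k \<in> {1..n - 1}" for k
  proof -
    have "int n - int k - 1 = int (n - k - 1)" using that by auto
    then show ?thesis by (simp only: power_int_of_nat)
  qed
  have powik2: "Q powi (int n - int k - 2) = Q ^ (n - k - 1) / Q" if "k \<in> {1..n - 1}" for k
    using power_int_diff[of Q "int n - int k - 1" 1] Q0 powik1[OF that] by simp

  show ?thesis
    unfolding Q_def[symmetric] P\<^sub>1_def[symmetric] P\<^sub>2_def[symmetric]
  proof (intro conjI impI)
    assume b: "b \<noteq> 0"
    have \<alpha>: "\<alpha> = - (1 / (2 * Q))" using b by (simp add: \<alpha>_def)
    \<comment> \<open>Here \<open>2 * \<alpha>\<close> is -1/Q, so the term k = 0 lowers the main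
      term.\<close>
    have "Q ^ n / Q + Q ^ (n - 1) * (2 * \<alpha>) = Q powi (int n - 2) * (Q - 1)"
      using Q0 by (simp add: \<alpha> powi2 Qn field_simps)
    moreover have "(\<Sum>k = 1..n - 1. Q powi (int n - int k - 1) *
        (- (1 / (2 * Q)) * (P\<^sub>1 k + P\<^sub>2 k) + \<eta> b / (2 * w) * (P\<^sub>1 k - P\<^sub>2 k))) =
        (\<Sum>k = 1..n - 1. Q ^ (n - k - 1) * (\<alpha> * (P\<^sub>1 k + P\<^sub>2 k) + \<beta> * (P\<^sub>1 k - P\<^sub>2 k)))"
      by (intro sum.cong refl) (simp only: powik1 \<alpha> \<beta>_def)
    ultimately show "of_nat (num_roots n f) = Q powi (int n - 2) * (Q - 1)
        - 1 / (2 * Q) * (P\<^sub>1 n + P\<^sub>2 n) + \<eta> b / (2 * w) * (P\<^sub>1 n - P\<^sub>2 n)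
        + (\<Sum>k = 1..n - 1. Q powi (int n - int k - 1) *
          (- (1 / (2 * Q)) * (P\<^sub>1 k + P\<^sub>2 k) + \<eta> b / (2 * w) * (P\<^sub>1 k - P\<^sub>2 k)))"
      unfolding N by (simp add: \<alpha> \<beta>_def)
  next
    assume b: "b = 0"
    have \<alpha>: "\<alpha> = (Q - 1) / (2 * Q)" using b Q0 by (simp add: \<alpha>_def field_simps)
    \<comment> \<open>The character vanishes at 0, so the differences of products drop out.\<close>
    have \<beta>: "\<beta> = 0" using b by (simp add: \<beta>_def \<eta>)
    have "Q ^ n / Q + Q ^ (n - 1) * (2 * \<alpha>) = Q powi (int n - 1) + Q powi (int n - 2) * (Q - 1)"
      using Q0 by (simp add: \<alpha> powi1 powi2 Qn field_simps)
    moreover have "(Q - 1) / 2 * (\<Sum>k = 1..n - 1. Q powi (int n - int k - 2) * (P\<^sub>1 k + P\<^sub>2 k)) =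
        (\<Sum>k = 1..n - 1. Q ^ (n - k - 1) * (\<alpha> * (P\<^sub>1 k + P\<^sub>2 k) + \<beta> * (P\<^sub>1 k - P\<^sub>2 k)))"
      unfolding sum_distrib_left by (intro sum.cong refl) (simp add: powik2 \<alpha> \<beta>)
    ultimately show "of_nat (num_roots n f) = Q powi (int n - 1) + Q powi (int n - 2) * (Q - 1)
        + (Q - 1) / (2 * Q) * (P\<^sub>1 n + P\<^sub>2 n)
        + (Q - 1) / 2 * (\<Sum>k = 1..n - 1. Q powi (int n - int k - 2) * (P\<^sub>1 k + P\<^sub>2 k))"
      unfolding N by (simp add: \<alpha> \<beta>)
  qed
qed

end
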